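(* Let $\chi(\cdot,3)$ be the non-principal Dirichlet character of modulus $3$ and $L(\cdot,\chi(\cdot,3))$ its Dirichlet $L$-function. Let $s\in\mathbb{C}$ with $\mathrm{Re}\,s\in(0,\infty)$, $\mathrm{Re}\,s\neq2,4,\ldots$, and $s\notin\mathbb{N}$, and put $m_1:=\lfloor(\mathrm{Re}\,s)/2\rfloor$. Then the following statements hold. (a) The function $$\gamma^*_{s,3}(y):=(1+2\cos y)\Bigg(-3^s\sum_{j=1}^{m_1}(-1)^{j-1}\Gamma(s-2j)\,L(s-2j,\chi(\cdot,3))(3y)^{2j}$$ $$\qquad+\frac{\pi3^{s-1/2}y^{2(m_1+1)}}{\sin(\pi s/2)}\Big(-\sum_{d=0}^\infty\frac{[2\pi(d+1/3)]^{s-2m_1-1}}{y^2-[2\pi(d+1/3)]^2}+\sum_{d=0}^\infty\frac{[2\pi(d+2/3)]^{s-2m_1-1}}{y^2-[2\pi(d+2/3)]^2}\Big)\Bigg)$$ is the only entire function of exponential type $1$ that interpolates the function $$\varphi^*_{s,3}(y):=\frac{\pi(3|y|)^s}{2\sin(\pi s/2)}$$ at the nodes $\{2\pi(d\pm1/3)\}_{d\in\mathbb{Z}}$ and satisfies the following conditions: (C1* ) $\varphi^*_{s,3}-\gamma^*_{s,3}\in L_\infty(\mathbb{R})$ and (C2* ) $\gamma^*_{s,3}(0)=0$. (b) In addition to (a), $$\varphi^*_{s,3}[2\pi(d\pm1/3)]=\gamma^*_{s,3}[2\pi(d\pm1/3)]=\frac{\pi3^s[2\pi|d\pm1/3|]^s}{2\sin(\pi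 s/2)},\qquad d\in\mathbb{Z}.$$ (c) The limit equality $$L(s,\chi(\cdot,3))=\frac{1}{3^s\Gamma(s)}\lim_{|y|\to\infty}\frac{\varphi^*_{s,3}(y)-\gamma^*_{s,3}(y)}{1+2\cos y}$$ is valid.
   Context: $\mathbb{N}=\{1,2,\ldots\}$. $\chi(l,3)=1,-1,0$ according as $l\equiv1,2,0\pmod 3$, and $L(s,\chi(\cdot,3))=\sum_{d=0}^\infty\big((3d+1)^{-s}-(3d+2)^{-s}\big)$ for $\mathrm{Re}\,s>0$. An entire function $g:\mathbb{C}\to\mathbb{C}$ has exponential type $\sigma$ if for every $\varepsilon>0$ there is a constant $C>0$ with $|g(z)|\le C\exp((\sigma+\varepsilon)|z|)$ for all $z\in\mathbb{C}$. An entire function is identified with its restriction to $\mathbb{R}$. Conventions: complex powers of positive reals are principal, $0^s=0$ when $\mathrm{Re}\,s>0$; the factor $1+2\cos y$ multiplies each term of the series, and at the points where a denominator $y^2-[2\pi(d+r/3)]^2$ vanishes the product $(1+2\cos y)/(y^2-[2\pi(d+r/3)]^2)$ is understood by continuity ($r=1,2$); an empty sum is zero. In the limit in (c), $y$ runs over real numbers with $1+2\cos y\neq0$.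
   Formalization: In the polynomial part of γ*, the factor (3y)^{2j} is corrected to y^{2j}; as printed, (C1* ) and the limit in (c) fail for Re s > 2 (e.g. s = 7/2), while for Re s < 2 the two formulas agree. *)

theory Defs
  imports "HOL-Complex_Analysis.Complex_Analysis"
begin

text \<open>
  The Dirichlet series of the non-principal character modulo 3, summed over full periods;
  in this grouping it converges for every \<open>s\<close> with positive real part.
\<close>

definition L_chi3 :: "complex \<Rightarrow> complex" where
  "L_chi3 s = (\<Sum>d. of_nat (3 * d + 1) powr (- s) - of_nat (3 * d + 2) powr (- s))"

definition of_exp_type :: "(complex \<Rightarrow> complex) \<Rightarrow> real \<Rightarrow> bool" where
  "of_exp_type g \<sigma> \<longleftrightarrow>
     (\<forall>\<epsilon>>0. \<exists>C>0. \<forall>z. norm (g z) \<le> C * exp ((\<sigma> + \<epsilon>) * norm z))"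

definition in_L_infinity :: "(real \<Rightarrow> complex) \<Rightarrow> bool" where
  "in_L_infinity f \<longleftrightarrow>
     f \<in> borel_measurable lebesgue \<and> (\<exists>C. AE x in lebesgue. norm (f x) \<le> C)"

definition m1 :: "complex \<Rightarrow> nat" where
  "m1 s = nat \<lfloor>Re s / 2\<rfloor>"

definition phi_star :: "complex \<Rightarrow> real \<Rightarrow> complex" where
  "phi_star s y =
     of_real pi * of_real (3 * \<bar>y\<bar>) powr s / (2 * sin (of_real pi * s / 2))"

text \<open>
  The quotient \<open>(1 + 2 cos z) / (z\<^sup>2 - a\<^sup>2)\<close>, extended by its limit to the points
  with \<open>z\<^sup>2 = a\<^sup>2\<close>.
\<close>

definition cos_quotient :: "real \<Rightarrow> complex \<Rightarrow> complex" where
  "cos_quotient a =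
     remove_sings (\<lambda>z. (1 + 2 * cos z) / (z ^ 2 - of_real a ^ 2))"

text \<open>
  The factor \<open>1 + 2 cos z\<close> of the interpolant is multiplied into the two series term by term,
  through \<open>cos_quotient\<close>.

  The polynomial part carries \<open>3\<^sup>s z\<^sup>2\<^sup>j\<close>. The source prints \<open>3\<^sup>s (3z)\<^sup>2\<^sup>j\<close>, which is a misprint:
  continuing the case \<open>Re s < 2\<close> analytically, with
  \<open>z\<^sup>2\<^sup>m\<^sup>+\<^sup>2 a\<^sup>-\<^sup>2\<^sup>m / (z\<^sup>2 - a\<^sup>2) = z\<^sup>2 / (z\<^sup>2 - a\<^sup>2) + (\<Sum>j=1..m. (z/a)\<^sup>2\<^sup>j)\<close>
  and the functional equation
  \<open>L(1 - u) = 2 3\<^sup>u\<^sup>-\<^sup>1\<^sup>/\<^sup>2 (2\<pi>)\<^sup>-\<^sup>u \<Gamma>(u) sin(\<pi>u/2) L(u)\<close> at \<open>u = s - 2j\<close>,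
  gives the coefficient \<open>- 3\<^sup>s (-1)\<^sup>j\<^sup>-\<^sup>1 \<Gamma>(s - 2j) L(s - 2j)\<close> of \<open>z\<^sup>2\<^sup>j\<close>. With \<open>(3z)\<^sup>2\<^sup>j\<close> the difference
  from \<open>phi_star s\<close> is unbounded on the real line (for instance at \<open>s = 7/2\<close>), and the
  limit for \<open>L(s)\<close> diverges. The two readings agree when \<open>Re s < 2\<close>.
\<close>

definition gamma_star :: "complex \<Rightarrow> complex \<Rightarrow> complex" where
  "gamma_star s z =
     (1 + 2 * cos z) *
       (- (3 powr s) *
          (\<Sum>j = 1..m1 s. (- 1) ^ (j - 1) * Gamma (s - of_nat (2 * j)) *
             L_chi3 (s - of_nat (2 * j)) * z ^ (2 * j)))
     + of_real pi * 3 powr (s - 1 / 2) * z ^ (2 * (m1 s + 1)) / sin (of_real pi * s / 2) *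
       (- (\<Sum>d. of_real (2 * pi * (real d + 1 / 3)) powr (s - of_nat (2 * m1 s) - 1) *
               cos_quotient (2 * pi * (real d + 1 / 3)) z)
        + (\<Sum>d. of_real (2 * pi * (real d + 2 / 3)) powr (s - of_nat (2 * m1 s) - 1) *
               cos_quotient (2 * pi * (real d + 2 / 3)) z))"

definition nodes :: "real set" where
  "nodes = (\<Union>d::int. {2 * pi * (of_int d + 1 / 3), 2 * pi * (of_int d - 1 / 3)})"

definition admissible_interpolant :: "complex \<Rightarrow> (complex \<Rightarrow> complex) \<Rightarrow> bool" where
  "admissible_interpolant s g \<longleftrightarrow>
     g holomorphic_on UNIV \<and> of_exp_type g 1 \<and>
     (\<forall>x\<in>nodes. g (of_real x) = phi_star s x) \<and>
     in_L_infinity (\<lambda>x. phi_star s x - g (of_real x)) \<and>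
     g 0 = 0"

end

theory Submission
  imports Defs "HOL-Real_Asymp.Real_Asymp"
begin

text \<open>
  Write \<open>F(t) = 1 / (1 + 2 cosh t)\<close>, so that \<open>\<Gamma>(s) L(s) = \<integral>\<^sub>0\<^sup>\<infinity> t\<^sup>s\<^sup>-\<^sup>1 F(t) dt\<close>. The function
  \<open>1 / (1 + 2 cos z)\<close> has simple poles at the nodes; evaluating its partial fraction expansion at
  \<open>z = i t\<close> expands \<open>F\<close>, and integrating term by term against \<open>t\<^sup>s\<^sup>-\<^sup>1 y\<^sup>2 / (y\<^sup>2 + t\<^sup>2)\<close> gives, for
  \<open>0 < Re s < 2\<close> and then, after splitting off powers of \<open>y\<^sup>2 / t\<^sup>2\<close>, for all admissible \<open>s\<close>,
  \<open>\<phi>(y) - \<gamma>(y) = 3\<^sup>s (1 + 2 cos y) \<integral>\<^sub>0\<^sup>\<infinity> t\<^sup>s\<^sup>-\<^sup>1 F(t) y\<^sup>2 / (y\<^sup>2 + t\<^sup>2) dt\<close>.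
  Boundedness of the remainder and the limit can be read off from this formula.

  For uniqueness, the difference \<open>h\<close> of two interpolants is of exponential type 1 and bounded on
  the real line, so \<open>h(z) = O(exp \<bar>Im z\<bar>)\<close> by Phragmen-Lindelof. Since \<open>h\<close> vanishes at all zeros
  of \<open>1 + 2 cos z\<close>, the quotient is a bounded entire function, hence constant, and \<open>h(0) = 0\<close>
  makes it vanish.
\<close>

subsection \<open>Functions of exponential type and uniqueness\<close>

text \<open>The weight \<open>y^2 / (y^2 + t^2)\<close> is chosen because its product with a term
  \<open>2 a / (t^2 + a^2)\<close> of the expansion of \<open>F\<close> splits, in the variable
  \<open>t^2\<close>, into two integrals of \<open>t powr (s - 1)\<close> over a sum of two squares.
  The one with \<open>a\<close> gives the term of the interpolant that belongs to the node
  \<open>a\<close>. The one with \<open>y\<close> gives a multiple of \<open>y powr s\<close>, and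
  these multiples resum, by the same partial fractions taken at the real point \<open>y\<close>, to
  a multiple of \<open>y powr s / (1 + 2 cos y)\<close>. Thus \<phi> and the series in \<gamma> have
  one source. The integrals converge only for \<open>0 < Re s < 2\<close>, and the lines
  \<open>Re s = 2, 4, ...\<close> separate the strips that are shifted to this one. Two obstacles
  shape the estimates. Over a single family of nodes the terms \<open>2 a / (t^2 + a^2)\<close>
  behave like a harmonic series, so the two families have to be paired index by index. Growth of
  order 1 is critical for Phragmen-Lindelof in a half-plane, so the argument starts in quadrants,
  where the critical order is 2.\<close>

lemma entire_quotient:
  assumes h: "h holomorphic_on UNIV" and c: "c holomorphic_on UNIV"
    and zero: "\<And>z. c z = 0 \<Longrightarrow> h z = 0" and simple: "\<And>z. c z = 0 \<Longrightarrow> deriv c z \<noteq> 0"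
  obtains K where "K holomorphic_on UNIV" "\<And>z. h z = K z * c z"
proof
  \<comment> \<open>At a simple zero of \<open>c\<close> the quotient tends to the quotient of the
    derivatives. With this value \<open>K\<close> is continuous there, and a continuous isolated
    singularity is removable.\<close>
  define K where "K = (\<lambda>z. if c z = 0 then deriv h z / deriv c z else h z / c z)"
  have "\<exists>e>0. K holomorphic_on ball p e" for p
  proof (cases "c p = 0")
    case False
    have "isCont c p"
      using holomorphic_on_imp_continuous_on[OF c] continuous_on_eq_continuous_at by blast
    then obtain e where e: "e > 0" "\<And>z. dist p z < e \<Longrightarrow> c z \<noteq> 0"
      using continuous_at_avoid[of p c 0] False by auto
    have "(\<lambda>z. h z / c z) holomorphic_on ball p e"
      using e by (intro holomorphic_intros holomorphic_on_subset[OF h] holomorphic_on_subset[OF c]) auto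
    hence "K holomorphic_on ball p e"
      by (rule holomorphic_transform) (use e in \<open>auto simp: K_def\<close>)
    thus ?thesis using e by blast
  next
    case True
    have dh: "(h has_field_derivative deriv h p) (at p)" and dc: "(c has_field_derivative deriv c p) (at p)"
      using h c by (auto intro!: holomorphic_derivI)
    have lh: "(\<lambda>z. h z / (z - p)) \<midarrow>p\<rightarrow> deriv h p" and lc: "(\<lambda>z. c z / (z - p)) \<midarrow>p\<rightarrow> deriv c p"
      using dh dc zero[OF True] True by (simp_all add: has_field_derivative_iff)
    have "eventually (\<lambda>z. c z / (z - p) \<noteq> 0) (at p)"
      using lc simple[OF True] by (rule tendsto_imp_eventually_ne)
    hence "eventually (\<lambda>z. c z \<noteq> 0) (at p)"
      by eventually_elim auto
    then obtain e where e: "e > 0" "\<And>z. z \<noteq> p \<Longrightarrow> dist z p < e \<Longrightarrow> c z \<noteq> 0"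
      by (auto simp: eventually_at)
    have "((\<lambda>z. (h z / (z - p)) / (c z / (z - p))) \<longlongrightarrow> deriv h p / deriv c p) (at p)"
      by (intro tendsto_divide lh lc simple True)
    moreover have "eventually (\<lambda>z. (h z / (z - p)) / (c z / (z - p)) = K z) (at p)"
      using \<open>eventually (\<lambda>z. c z \<noteq> 0) (at p)\<close> eventually_neq_at_within[of p p]
      by eventually_elim (auto simp: K_def)
    ultimately have "(K \<longlongrightarrow> K p) (at p)"
      using True by (auto simp: K_def intro: Lim_transform_eventually)
    hence cont: "isCont K p" by (simp add: isCont_def)
    have "(\<lambda>z. h z / c z) holomorphic_on ball p e - {p}"
      using e by (intro holomorphic_intros holomorphic_on_subset[OF h] holomorphic_on_subset[OF c])
                 (auto simp: dist_commute)
    hence hol: "K holomorphic_on ball p e - {p}"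
      by (rule holomorphic_transform) (use e in \<open>auto simp: K_def dist_commute\<close>)
    have "K holomorphic_on ball p e"
    proof (rule no_isolated_singularity)
      have "isCont K z" if "z \<in> ball p e" for z
        using cont hol that holomorphic_on_imp_continuous_on[OF hol]
        by (cases "z = p") (auto simp: continuous_on_eq_continuous_at open_delete)
      thus "continuous_on (ball p e) K"
        by (intro continuous_at_imp_continuous_on) auto
    qed (use hol in auto)
    thus ?thesis using e by blast
  qed
  thus "K holomorphic_on UNIV"
    by (intro analytic_imp_holomorphic) (auto simp: analytic_on_def)
  show "h z = K z * c z" for z
    using zero by (auto simp: K_def)
qed

text \<open>For \<open>z\<close> in the closed first quadrant \<open>csqrt z ^ 3\<close> has an
  argument between 0 and 135 degrees, so its real part alone may be negative. The factor
  \<open>1 - 2 * \<i>\<close> turns it back by about 63 degrees, into a sector strictly narrower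
  than the right half-plane. In coordinates the left-hand side is \<open>Re u + 2 * Im u\<close> for
  \<open>u = csqrt z ^ 3\<close>.\<close>

lemma csqrt_cube_bound:
  assumes "Re z \<ge> 0" "Im z \<ge> 0"
  shows "Re ((1 - 2 * \<i>) * csqrt z ^ 3) \<ge> (norm z / 2) powr (3 / 2)"
proof -
  define p q where "p = Re (csqrt z)" and "q = Im (csqrt z)"
  have u: "csqrt z = Complex p q" by (simp add: p_def q_def complex_eq_iff)
  have z: "z = (Complex p q)\<^sup>2" by (metis u power2_csqrt)
  have p0: "p \<ge> 0" using csqrt_principal[of z] by (auto simp: p_def)
  have pq: "p\<^sup>2 \<ge> q\<^sup>2" "p * q \<ge> 0"
    using assms by (auto simp: z power2_eq_square)
  have q0: "q \<ge> 0"
    using pq p0 by (smt (verit) mult_eq_0_iff power_zero_numeral zero_le_mult_iff zero_le_power2 power2_eq_square)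
  have qp: "q \<le> p" using pq p0 by (meson abs_le_square_iff power2_le_imp_le)
  have "norm z = p\<^sup>2 + q\<^sup>2" by (simp add: z norm_power cmod_power2)
  hence "norm z / 2 \<le> p\<^sup>2" using pq by simp
  hence "(norm z / 2) powr (3/2) \<le> (p\<^sup>2) powr (3/2)"
    by (intro powr_mono2) auto
  also have "(p\<^sup>2) powr (3/2) = p ^ 3"
    using p0 by (cases "p = 0") (auto simp: powr_powr simp flip: powr_numeral)
  also have "p ^ 3 \<le> p ^ 3 - 3 * p * q\<^sup>2 + 2 * (3 * p\<^sup>2 * q - q ^ 3)"
  proof -
    have "q * q \<le> p * q" "q * q \<le> p * p" using qp q0 p0 by (auto intro: mult_mono mult_right_mono)
    hence "p * (q * q) \<le> p * (p * q)" "q * (q * q) \<le> q * (p * p)"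
      using p0 q0 by (auto intro!: mult_left_mono)
    moreover have "0 \<le> p * (p * q)" using p0 q0 by auto
    ultimately show ?thesis
      by (simp add: power2_eq_square power3_eq_cube algebra_simps)
  qed
  also have "\<dots> = Re ((1 - 2 * \<i>) * csqrt z ^ 3)"
    by (simp add: u power3_eq_cube power2_eq_square algebra_simps)
  finally show ?thesis .
qed

text \<open>
  On the quadrant the multiplier \<open>exp (- \<delta> (1 - 2 \<i>) (z + 1)\<^sup>3\<^sup>/\<^sup>2)\<close> has modulus at most 1 and
  decays faster than every exponential; the shift by 1 keeps the branch cut of the root away.
\<close>
lemma phragmen_lindelof_quadrant:
  assumes f: "f holomorphic_on UNIV"
    and growth: "\<And>z. norm (f z) \<le> A * exp (B * norm z)" and AB: "A \<ge> 0" "B \<ge> 0"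
    and re: "\<And>x. x \<ge> 0 \<Longrightarrow> norm (f (of_real x)) \<le> M"
    and im: "\<And>y. y \<ge> 0 \<Longrightarrow> norm (f (\<i> * of_real y)) \<le> M"
    and z: "Re z \<ge> 0" "Im z \<ge> 0"
  shows "norm (f z) \<le> M"
proof -
  have M0: "M \<ge> 0" using re[of 0] norm_ge_zero order_trans by blast
  define E where "E = (\<lambda>z. (1 - 2 * \<i>) * csqrt (z + 1) ^ 3)"
  have Epos: "Re (E z) \<ge> (norm (z + 1) / 2) powr (3/2)" if "Re z \<ge> 0" "Im z \<ge> 0" for z
    unfolding E_def using that by (intro csqrt_cube_bound) auto
  have *: "norm (f z) * exp (- \<delta> * Re (E z)) \<le> M" if d: "\<delta> > 0" for \<delta>
  proof -
    define G where "G = (\<lambda>z. f z * exp (- of_real \<delta> * E z))"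
    have nG: "norm (G z) = norm (f z) * exp (- \<delta> * Re (E z))" for z
      by (simp add: G_def norm_mult)
    \<comment> \<open>The order 3/2 of the multiplier beats the order 1 of the growth of
      \<open>f\<close>, so the product tends to 0 along large arcs; the shift by 1 inside
      \<open>E\<close> costs the \<open>r - 1\<close>.\<close>
    have lim: "((\<lambda>r::real. A * exp (B * r - \<delta> * ((r - 1) / 2) powr (3/2))) \<longlongrightarrow> 0) at_top"
    proof -
      have "filterlim (\<lambda>r::real. \<delta> * ((r - 1) / 2) powr (3/2) - B * r) at_top at_top"
        using d by real_asymp
      hence "filterlim (\<lambda>r::real. - (\<delta> * ((r - 1) / 2) powr (3/2) - B * r)) at_bot at_top"
        by (simp add: filterlim_uminus_at_bot)
      hence "((\<lambda>r::real. exp (B * r - \<delta> * ((r - 1) / 2) powr (3/2))) \<longlongrightarrow> 0) at_top"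
        by (intro filterlim_compose[OF exp_at_bot]) (simp add: algebra_simps)
      from tendsto_mult_left[OF this, of A] show ?thesis by simp
    qed
    have "norm (G z) \<le> M + e" if e: "e > 0" for e
    proof -
      have "eventually (\<lambda>r. A * exp (B * r - \<delta> * ((r - 1) / 2) powr (3/2)) < e) at_top"
        using order_tendstoD(2)[OF lim e] .
      with eventually_ge_at_top[of "norm z + 1"]
      have "eventually (\<lambda>r. A * exp (B * r - \<delta> * ((r - 1) / 2) powr (3/2)) < e \<and> r \<ge> norm z + 1) at_top"
        by eventually_elim auto
      then obtain r where r: "A * exp (B * r - \<delta> * ((r - 1) / 2) powr (3/2)) < e" "r \<ge> norm z + 1"
        by (auto simp: eventually_at_top_linorder)
      have r1: "r \<ge> 1" using r(2) norm_ge_zero[of z] by linarith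
      define S where "S = {w. Re w \<ge> 0} \<inter> {w. Im w \<ge> 0} \<inter> cball 0 r"
      have clS: "closed S"
        unfolding S_def by (intro closed_Int closed_halfspace_Re_ge closed_halfspace_Im_ge) auto
      have holG: "G holomorphic_on {w. Re w > - 1}"
        unfolding G_def E_def
        by (intro holomorphic_intros holomorphic_on_subset[OF f]) (auto simp: complex_nonpos_Reals_iff)
      have sub: "S \<subseteq> {w. Re w > - 1}" by (auto simp: S_def)
      have fr: "Re w = 0 \<or> Im w = 0 \<or> norm w = r" if "w \<in> frontier S" for w
      proof (rule ccontr)
        assume neg: "\<not> ?thesis"
        have "w \<in> S" using that clS frontier_subset_closed by blast
        with neg have "w \<in> {w. Re w > 0} \<inter> {w. Im w > 0} \<inter> ball 0 r"
          by (auto simp: S_def)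
        moreover have "open ({w. Re w > 0} \<inter> {w. Im w > 0} \<inter> ball 0 r)"
          by (intro open_Int open_halfspace_Re_gt open_halfspace_Im_gt) auto
        moreover have "{w. Re w > 0} \<inter> {w. Im w > 0} \<inter> ball 0 r \<subseteq> S" by (auto simp: S_def)
        ultimately have "w \<in> interior S" by (meson interiorI)
        thus False using that by (simp add: frontier_def)
      qed
      show ?thesis
      proof (rule maximum_modulus_frontier[of G S])
        show "G holomorphic_on interior S"
          using holG by (rule holomorphic_on_subset) (use sub interior_subset in blast)
        show "continuous_on (closure S) G"
          using holomorphic_on_imp_continuous_on[OF holG] sub clS
          by (metis closure_closed continuous_on_subset)
        show "bounded S" by (auto simp: S_def intro: bounded_subset[OF bounded_cball])
        show "z \<in> S" using z r by (auto simp: S_def)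
        fix w assume w: "w \<in> frontier S"
        hence wS: "w \<in> S" using clS frontier_subset_closed by blast
        hence w0: "Re w \<ge> 0" "Im w \<ge> 0" "norm w \<le> r" by (auto simp: S_def)
        have E0: "Re (E w) \<ge> 0" using Epos[OF w0(1,2)] by (smt (verit) powr_ge_zero)
        have ex1: "exp (- \<delta> * Re (E w)) \<le> 1" using E0 d by simp
        from fr[OF w] consider "Re w = 0" | "Im w = 0" | "norm w = r" by auto
        thus "norm (G w) \<le> M + e"
        proof cases
          case 1
          hence "w = \<i> * of_real (Im w)" by (simp add: complex_eq_iff)
          hence "norm (f w) \<le> M" using im[OF w0(2)] by simp
          hence "norm (G w) \<le> M * 1" unfolding nG using ex1 M0 by (intro mult_mono) auto
          thus ?thesis using e by simp
        next
          case 2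
          hence "w = of_real (Re w)" by (simp add: complex_eq_iff)
          hence "norm (f w) \<le> M" using re[OF w0(1)] by metis
          hence "norm (G w) \<le> M * 1" unfolding nG using ex1 M0 by (intro mult_mono) auto
          thus ?thesis using e by simp
        next
          case 3
          have "norm (w + 1) \<ge> r - 1" using 3 norm_triangle_ineq4[of "w + 1" 1] by simp
          hence "((r - 1) / 2) powr (3/2) \<le> (norm (w + 1) / 2) powr (3/2)"
            using r1 by (intro powr_mono2) auto
          also note Epos[OF w0(1,2)]
          finally have "\<delta> * ((r - 1) / 2) powr (3/2) \<le> \<delta> * Re (E w)" using d by simp
          hence "exp (- \<delta> * Re (E w)) \<le> exp (- \<delta> * ((r - 1) / 2) powr (3/2))" by simp
          hence "norm (G w) \<le> A * exp (B * r) * exp (- \<delta> * ((r - 1) / 2) powr (3/2))"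
            unfolding nG using growth[of w] 3 AB by (intro mult_mono) auto
          also have "\<dots> = A * exp (B * r - \<delta> * ((r - 1) / 2) powr (3/2))"
            by (simp add: exp_diff exp_minus field_simps)
          finally show ?thesis using r M0 by simp
        qed
      qed
    qed
    hence "norm (G z) \<le> M" by (rule field_le_epsilon)
    thus ?thesis by (simp add: nG)
  qed
  \<comment> \<open>The bound \<open>M\<close> is free of \<delta>, so for fixed \<open>z\<close>
    the multiplier disappears in the limit.\<close>
  have "((\<lambda>\<delta>. norm (f z) * exp (- \<delta> * Re (E z))) \<longlongrightarrow> norm (f z) * exp (- 0 * Re (E z))) (at_right 0)"
    by (intro tendsto_intros)
  hence "((\<lambda>\<delta>. norm (f z) * exp (- \<delta> * Re (E z))) \<longlongrightarrow> norm (f z)) (at_right 0)" by simp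
  moreover have "eventually (\<lambda>\<delta>. norm (f z) * exp (- \<delta> * Re (E z)) \<le> M) (at_right 0)"
    using eventually_at_right_less[of "0::real"] by eventually_elim (use * in simp)
  ultimately show ?thesis
    by (rule tendsto_upperbound) auto
qed


text \<open>The two quadrants give the preliminary bound \<open>max M M'\<close>. To get rid of
  \<open>M'\<close>, divide by \<open>1 - \<i> * \<delta> * z\<close>: its modulus is at least 1 on
  the upper half-plane and grows linearly, so the preliminary bound makes the quotient small on
  large arcs and only the bound \<open>M\<close> on the real axis survives as \<delta> tends to
  0.\<close>

lemma phragmen_lindelof_half_plane:
  assumes f: "f holomorphic_on UNIV"
    and growth: "\<And>z. norm (f z) \<le> A * exp (B * norm z)" and AB: "A \<ge> 0" "B \<ge> 0"
    and re: "\<And>x::real. norm (f (of_real x)) \<le> M"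
    and im: "\<And>y. y \<ge> 0 \<Longrightarrow> norm (f (\<i> * of_real y)) \<le> M'"
    and z: "Im z \<ge> 0"
  shows "norm (f z) \<le> M"
proof -
  define N where "N = max M M'"
  have M0: "M \<ge> 0" using re[of 0] norm_ge_zero order_trans by blast
  have bounded: "norm (f w) \<le> N" if "Im w \<ge> 0" for w
  proof (cases "Re w \<ge> 0")
    case True
    show ?thesis
      by (rule phragmen_lindelof_quadrant[OF f growth AB _ _ True that])
         (use re im in \<open>auto simp: N_def le_max_iff_disj\<close>)
  next
    case False
    \<comment> \<open>Multiplication by \<open>\<i>\<close> carries the first quadrant onto the
      second, and its imaginary axis onto the negative reals.\<close>
    have "norm (f (\<i> * (w / \<i>))) \<le> N"
    proof (rule phragmen_lindelof_quadrant[of "\<lambda>z. f (\<i> * z)" A B N "w / \<i>"])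
      show "(\<lambda>z. f (\<i> * z)) holomorphic_on UNIV"
        by (rule holomorphic_on_compose_gen[of _ _ f UNIV, unfolded o_def])
           (auto intro!: holomorphic_intros f)
      show "norm (f (\<i> * z)) \<le> A * exp (B * norm z)" for z
        using growth[of "\<i> * z"] by (simp add: norm_mult)
      show "norm (f (\<i> * (\<i> * of_real y))) \<le> N" for y
        using re[of "-y"] by (simp add: N_def le_max_iff_disj flip: mult.assoc)
    qed (use AB that False im in \<open>auto simp: N_def le_max_iff_disj Re_divide Im_divide\<close>)
    thus ?thesis by simp
  qed
  have N0: "N \<ge> 0" using M0 by (simp add: N_def)
  have *: "norm (f z / (1 - \<i> * of_real \<delta> * z)) \<le> M" if d: "\<delta> > 0" for \<delta>
  proof -
    have den: "norm (1 - \<i> * of_real \<delta> * w) \<ge> 1" if "Im w \<ge> 0" for w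
    proof -
      have "1 \<le> Re (1 - \<i> * of_real \<delta> * w)" using that d by simp
      thus ?thesis using complex_Re_le_cmod order_trans by blast
    qed
    show ?thesis
    proof (rule field_le_epsilon)
      fix e :: real assume e: "e > 0"
      \<comment> \<open>On the arc the divisor has modulus at least \<open>\<delta> * r - 1\<close>,
        hence at least \<open>N / e\<close>; the summand \<open>norm z\<close> puts \<open>z\<close>
        into the half-disc.\<close>
      define r where "r = norm z + (N / e + 1) / \<delta>"
      define S where "S = {w. Im w \<ge> 0} \<inter> cball 0 r"
      have clS: "closed S"
        unfolding S_def by (intro closed_Int closed_halfspace_Im_ge) auto
      have nz: "1 - \<i> * of_real \<delta> * w \<noteq> 0" if "w \<in> S" for w
        using den[of w] that by (auto simp: S_def)
      have cont: "continuous_on S (\<lambda>z. f z / (1 - \<i> * of_real \<delta> * z))"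
        using nz by (intro continuous_intros continuous_on_subset[OF holomorphic_on_imp_continuous_on[OF f]]) auto
      have hol: "(\<lambda>z. f z / (1 - \<i> * of_real \<delta> * z)) holomorphic_on interior S"
        using nz interior_subset[of S] by (intro holomorphic_intros holomorphic_on_subset[OF f]) auto
      have fr: "Im w = 0 \<or> norm w = r" if "w \<in> frontier S" for w
      proof (rule ccontr)
        assume neg: "\<not> ?thesis"
        have "w \<in> S" using that clS frontier_subset_closed by blast
        with neg have "w \<in> {w. Im w > 0} \<inter> ball 0 r" by (auto simp: S_def)
        moreover have "open ({w. Im w > 0} \<inter> ball 0 r)"
          by (intro open_Int open_halfspace_Im_gt) auto
        moreover have "{w. Im w > 0} \<inter> ball 0 r \<subseteq> S" by (auto simp: S_def)
        ultimately have "w \<in> interior S" by (meson interiorI)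
        thus False using that by (simp add: frontier_def)
      qed
      show "norm (f z / (1 - \<i> * of_real \<delta> * z)) \<le> M + e"
      proof (rule maximum_modulus_frontier[of "\<lambda>z. f z / (1 - \<i> * of_real \<delta> * z)" S])
        show "continuous_on (closure S) (\<lambda>z. f z / (1 - \<i> * of_real \<delta> * z))"
          using cont clS by simp
        show "bounded S" by (auto simp: S_def intro: bounded_subset[OF bounded_cball])
        show "z \<in> S" using z d e N0 by (auto simp: S_def r_def)
        fix w assume w: "w \<in> frontier S"
        hence wS: "w \<in> S" using clS frontier_subset_closed by blast
        hence w0: "Im w \<ge> 0" by (auto simp: S_def)
        from fr[OF w] show "norm (f w / (1 - \<i> * of_real \<delta> * w)) \<le> M + e"
        proof
          assume "Im w = 0"
          hence "w = of_real (Re w)" by (simp add: complex_eq_iff)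
          hence "norm (f w) \<le> M" using re by metis
          hence "norm (f w) / norm (1 - \<i> * of_real \<delta> * w) \<le> M / 1"
            using den[OF w0] M0 by (intro frac_le) auto
          thus ?thesis using e by (simp add: norm_divide)
        next
          assume wr: "norm w = r"
          have "N / e \<le> \<delta> * r - 1" using d by (simp add: r_def field_simps)
          also have "\<dots> \<le> norm (1 - \<i> * of_real \<delta> * w)"
            using norm_triangle_ineq2[of "\<i> * of_real \<delta> * w" 1] wr d
            by (simp add: norm_mult norm_minus_commute)
          finally have "N \<le> e * norm (1 - \<i> * of_real \<delta> * w)"
            using e by (simp add: field_simps)
          hence "norm (f w) \<le> e * norm (1 - \<i> * of_real \<delta> * w)"
            using bounded[OF w0] by simp
          hence "norm (f w / (1 - \<i> * of_real \<delta> * w)) \<le> e"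
            using den[OF w0] e by (auto simp: norm_divide divide_le_eq)
          thus ?thesis using M0 by simp
        qed
      qed (rule hol)
    qed
  qed
  have "((\<lambda>\<delta>. norm (f z / (1 - \<i> * of_real \<delta> * z))) \<longlongrightarrow> norm (f z / (1 - \<i> * of_real 0 * z))) (at_right 0)"
    by (intro tendsto_intros) auto
  hence "((\<lambda>\<delta>. norm (f z / (1 - \<i> * of_real \<delta> * z))) \<longlongrightarrow> norm (f z)) (at_right 0)" by simp
  moreover have "eventually (\<lambda>\<delta>. norm (f z / (1 - \<i> * of_real \<delta> * z)) \<le> M) (at_right 0)"
    using eventually_at_right_less[of "0::real"] by eventually_elim (use * in simp)
  ultimately show ?thesis
    by (rule tendsto_upperbound) auto
qed

text \<open>Multiplying by \<open>exp (\<i> * (\<sigma> + \<epsilon>) * z)\<close> keeps the modulus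
  on the real axis and cancels the growth on the positive imaginary axis. The constant of the
  exponential type bounds the product only on that axis, so it does not enter the result, and
  \<epsilon> can be sent to 0.\<close>

lemma exp_type_bounded_on_real_upper:
  assumes f: "f holomorphic_on UNIV" and type: "of_exp_type f \<sigma>" and "\<sigma> \<ge> 0"
    and re: "\<And>x::real. norm (f (of_real x)) \<le> M" and z: "Im z \<ge> 0"
  shows "norm (f z) \<le> M * exp (\<sigma> * Im z)"
proof -
  have *: "norm (f z) \<le> M * exp ((\<sigma> + \<epsilon>) * Im z)" if e: "\<epsilon> > 0" for \<epsilon>
  proof -
    obtain C where C: "C > 0" "\<And>z. norm (f z) \<le> C * exp ((\<sigma> + \<epsilon>) * norm z)"
      using type e unfolding of_exp_type_def by blast
    define F where "F = (\<lambda>z. f z * exp (\<i> * of_real (\<sigma> + \<epsilon>) * z))"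
    have nF: "norm (F w) = norm (f w) * exp (- (\<sigma> + \<epsilon>) * Im w)" for w
      by (simp add: F_def norm_mult algebra_simps)
    have "norm (F z) \<le> M"
    proof (rule phragmen_lindelof_half_plane[OF _ _ _ _ _ _ z])
      show "F holomorphic_on UNIV" unfolding F_def by (intro holomorphic_intros f)
      show "norm (F w) \<le> C * exp (2 * (\<sigma> + \<epsilon>) * norm w)" for w
      proof -
        have "(\<sigma> + \<epsilon>) * (- Im w) \<le> (\<sigma> + \<epsilon>) * norm w"
          using abs_Im_le_cmod[of w] e \<open>\<sigma> \<ge> 0\<close> by (intro mult_left_mono) auto
        hence "exp (- (\<sigma> + \<epsilon>) * Im w) \<le> exp ((\<sigma> + \<epsilon>) * norm w)" by (simp add: algebra_simps)
        hence "norm (F w) \<le> (C * exp ((\<sigma> + \<epsilon>) * norm w)) * exp ((\<sigma> + \<epsilon>) * norm w)"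
          unfolding nF using C by (intro mult_mono) auto
        also have "\<dots> = C * exp (2 * (\<sigma> + \<epsilon>) * norm w)" by (simp add: algebra_simps flip: exp_add)
        finally show ?thesis .
      qed
      show "norm (F (of_real x)) \<le> M" for x using re[of x] by (simp add: nF)
      show "norm (F (\<i> * of_real y)) \<le> C" if "y \<ge> 0" for y
      proof -
        have "norm (F (\<i> * of_real y)) \<le> (C * exp ((\<sigma> + \<epsilon>) * y)) * exp (- (\<sigma> + \<epsilon>) * y)"
          unfolding nF using C(2)[of "\<i> * of_real y"] that C(1) by (intro mult_mono) (auto simp: norm_mult)
        thus ?thesis by (simp add: algebra_simps flip: exp_add)
      qed
    qed (use C e \<open>\<sigma> \<ge> 0\<close> in auto)
    thus ?thesis by (simp add: nF exp_minus exp_diff exp_add ring_distribs field_simps)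
  qed
  have "((\<lambda>\<epsilon>. M * exp ((\<sigma> + \<epsilon>) * Im z)) \<longlongrightarrow> M * exp ((\<sigma> + 0) * Im z)) (at_right 0)"
    by (intro tendsto_intros)
  hence "((\<lambda>\<epsilon>. M * exp ((\<sigma> + \<epsilon>) * Im z)) \<longlongrightarrow> M * exp (\<sigma> * Im z)) (at_right 0)" by simp
  moreover have "eventually (\<lambda>\<epsilon>. M * exp ((\<sigma> + \<epsilon>) * Im z) \<ge> norm (f z)) (at_right 0)"
    using eventually_at_right_less[of "0::real"] by eventually_elim (use * in simp)
  ultimately show ?thesis
    by (rule tendsto_lowerbound) auto
qed

lemma exp_type_bounded_on_real:
  assumes f: "f holomorphic_on UNIV" and type: "of_exp_type f \<sigma>" and "\<sigma> \<ge> 0"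
    and re: "\<And>x::real. norm (f (of_real x)) \<le> M"
  shows "norm (f z) \<le> M * exp (\<sigma> * \<bar>Im z\<bar>)"
proof (cases "Im z \<ge> 0")
  case True
  thus ?thesis using exp_type_bounded_on_real_upper[OF assms] by simp
next
  case False
  have "norm (f (- (- z))) \<le> M * exp (\<sigma> * Im (- z))"
  proof (rule exp_type_bounded_on_real_upper)
    show "(\<lambda>z. f (- z)) holomorphic_on UNIV"
      by (rule holomorphic_on_compose_gen[of _ _ f UNIV, unfolded o_def])
         (auto intro!: holomorphic_intros f)
    show "of_exp_type (\<lambda>z. f (- z)) \<sigma>"
      using type unfolding of_exp_type_def by (metis norm_minus_cancel)
    show "norm (f (- of_real x)) \<le> M" for x using re[of "- x"] by simp
  qed (use assms False in auto)
  thus ?thesis using False by simp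
qed


section \<open>Zeros and lower bounds of \<open>1 + 2 * cos z\<close>\<close>

lemma cos_sin_2pi_thirds: "cos (2 * pi / 3) = - 1 / 2" "sin (2 * pi / 3) = sqrt 3 / 2"
  using cos_120 sin_120 by simp_all

lemma one_plus_2cos_eq_0_iff: "1 + 2 * cos z = 0 \<longleftrightarrow> (\<exists>x\<in>nodes. z = complex_of_real x)"
proof -
  have "cos (of_real (2 * pi / 3)) = (- 1 / 2 :: complex)"
    by (subst cos_of_real) (simp only: cos_sin_2pi_thirds, simp)
  hence "1 + 2 * cos z = 0 \<longleftrightarrow> cos z = cos (of_real (2 * pi / 3))"
    by (simp only:) (auto simp: complex_eq_iff)
  also have "\<dots> \<longleftrightarrow> (\<exists>n::int. z = of_real (2 * pi * (of_int n + 1 / 3)) \<or> z = of_real (2 * pi * (of_int n - 1 / 3)))"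
    unfolding complex_cos_eq Ints_def by (simp add: algebra_simps)
  also have "\<dots> \<longleftrightarrow> (\<exists>x\<in>nodes. z = complex_of_real x)"
    unfolding nodes_def by auto
  finally show ?thesis .
qed

text \<open>Away from the real axis one of the two exponentials in \<open>2 * cos z\<close>
  dominates. From height 2 on it is at least 4, so the other exponential and the constant 1 together
  cost at most half of it.\<close>

lemma norm_one_plus_2cos_ge:
  assumes "\<bar>Im z\<bar> \<ge> 2"
  shows "norm (1 + 2 * cos z) \<ge> exp \<bar>Im z\<bar> / 2"
proof -
  have *: "norm (2 * cos z) \<ge> exp \<bar>Im z\<bar> - exp (- \<bar>Im z\<bar>)"
  proof -
    have "2 * cos z = exp (\<i> * z) + exp (- (\<i> * z))" by (simp add: cos_exp_eq)
    moreover have "norm (exp (\<i> * z)) = exp (- Im z)" "norm (exp (- (\<i> * z))) = exp (Im z)" by simp_all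
    ultimately show ?thesis
      using norm_triangle_ineq2[of "exp (\<i> * z)" "- exp (- (\<i> * z))"]
        norm_triangle_ineq2[of "exp (- (\<i> * z))" "- exp (\<i> * z)"]
      by (cases "Im z \<ge> 0") (auto simp: add.commute)
  qed
  have "4 \<le> exp (2::real)" using exp_ge_one_plus_x_over_n_power_n[of 2 "2::real"] by simp
  also have "\<dots> \<le> exp \<bar>Im z\<bar>" using assms by simp
  finally have e4: "exp \<bar>Im z\<bar> \<ge> 4" .
  hence "exp (- \<bar>Im z\<bar>) \<le> 1 / 4" by (simp add: exp_minus field_simps)
  with * e4 norm_triangle_ineq4[of "1 + 2 * cos z" 1] show ?thesis by simp
qed

text \<open>On these vertical lines \<open>cos z\<close> has the real part
  \<open>cosh (Im z)\<close>. The lines stay away from the nodes and serve as sides of the boxes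
  into which the strip around the real axis is cut.\<close>

lemma norm_one_plus_2cos_ge_3:
  assumes "Re z = 2 * pi * of_int k"
  shows "norm (1 + 2 * cos z) \<ge> 3"
proof -
  have "Re (cos z) = cosh (Im z)" 
    using assms cos_int_2pin[of k] by (simp add: Re_cos cosh_def mult_ac)
  hence "3 \<le> Re (1 + 2 * cos z)" using cosh_real_ge_1[of "Im z"] by simp
  thus ?thesis using complex_Re_le_cmod order_trans by blast
qed

text \<open>Type 1 is exactly the growth of \<open>1 + 2 * cos z\<close>, so the quotient is bounded
  outside the strip of height 2. Inside it the divisor is small near the nodes and gives no direct
  bound; there the maximum principle on a box, whose sides avoid the nodes, carries the bound from
  the boundary inwards.\<close>

lemma exp_type_1_eq_0:
  assumes h: "h holomorphic_on UNIV" and type: "of_exp_type h 1"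
    and re: "\<And>x::real. norm (h (of_real x)) \<le> M"
    and nodes: "\<And>x. x \<in> nodes \<Longrightarrow> h (of_real x) = 0" and "h 0 = 0"
  shows "h z = 0"
proof -
  have M0: "M \<ge> 0" using re[of 0] norm_ge_zero order_trans by blast
  define c where "c = (\<lambda>z::complex. 1 + 2 * cos z)"
  have c: "c holomorphic_on UNIV" unfolding c_def by (intro holomorphic_intros)
  have deriv: "deriv c z \<noteq> 0" if "c z = 0" for z
  proof
    have "deriv c z = - 2 * sin z" unfolding c_def by (auto intro!: DERIV_imp_deriv derivative_eq_intros)
    moreover assume "deriv c z = 0"
    ultimately have "sin z = 0" by simp
    moreover have "cos z = - 1 / 2" using that by (simp add: c_def add_eq_0_iff field_simps)
    ultimately show False using sin_cos_squared_add[of z] by (simp add: power2_eq_square)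
  qed
  have "h z = 0" if "c z = 0" for z
    using that nodes unfolding c_def one_plus_2cos_eq_0_iff by auto
  then obtain K where K: "K holomorphic_on UNIV" "\<And>z. h z = K z * c z"
    using entire_quotient[OF h c _ deriv] by metis
  have hM: "norm (h z) \<le> M * exp \<bar>Im z\<bar>" for z
    using exp_type_bounded_on_real[OF h type _ re] by simp
  have K1: "norm (K z) \<le> 2 * M" if "\<bar>Im z\<bar> \<ge> 2" for z
  proof -
    have "norm (K z) * (exp \<bar>Im z\<bar> / 2) \<le> norm (K z) * norm (c z)"
      unfolding c_def by (intro mult_left_mono norm_one_plus_2cos_ge that) auto
    also have "\<dots> \<le> M * exp \<bar>Im z\<bar>" using hM[of z] by (simp add: K norm_mult)
    finally show ?thesis by simp
  qed
  have K2: "norm (K z) \<le> M * exp 2" if "Re z = 2 * pi * of_int k" "\<bar>Im z\<bar> \<le> 2" for z k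
  proof -
    have "norm (K z) * 1 \<le> norm (K z) * norm (c z)"
      using norm_one_plus_2cos_ge_3[OF that(1)] unfolding c_def by (intro mult_left_mono) auto
    also have "\<dots> \<le> M * exp \<bar>Im z\<bar>" using hM[of z] by (simp add: K norm_mult)
    also have "\<dots> \<le> M * exp 2" using that M0 by (intro mult_left_mono) auto
    finally show ?thesis by simp
  qed
  define B where "B = max (2 * M) (M * exp 2)"
  have "norm (K z) \<le> B" for z
  proof (cases "\<bar>Im z\<bar> \<ge> 2")
    case True
    thus ?thesis using K1[of z] by (simp add: B_def)
  next
    case False
    define k where "k = \<lfloor>Re z / (2 * pi)\<rfloor>"
    define S where "S = cbox (Complex (2 * pi * of_int k) (- 2)) (Complex (2 * pi * of_int (k + 1)) 2)"
    have "of_int k \<le> Re z / (2 * pi)" "Re z / (2 * pi) < of_int (k + 1)"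
      unfolding k_def by linarith+
    hence zS: "z \<in> S" using False pi_gt_zero by (auto simp: S_def in_cbox_complex_iff field_simps)
    show ?thesis
    proof (rule maximum_modulus_frontier[of K S])
      show "K holomorphic_on interior S" using K by (auto intro: holomorphic_on_subset)
      show "continuous_on (closure S) K" using K holomorphic_on_imp_continuous_on continuous_on_subset by blast
      show "bounded S" unfolding S_def by (rule bounded_cbox)
      fix w assume "w \<in> frontier S"
      hence "w \<in> S - box (Complex (2 * pi * of_int k) (- 2)) (Complex (2 * pi * of_int (k + 1)) 2)"
        by (simp add: S_def frontier_cbox)
      hence "\<bar>Im w\<bar> = 2 \<or> (\<bar>Im w\<bar> \<le> 2 \<and> (Re w = 2 * pi * of_int k \<or> Re w = 2 * pi * of_int (k + 1)))"
        by (auto simp: S_def in_cbox_complex_iff in_box_complex_iff)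
      thus "norm (K w) \<le> B"
        using K1[of w] K2[of w] unfolding B_def by (metis le_max_iff_disj order_refl)
    qed (rule zS)
  qed
  hence "bounded (range K)" by (auto simp: bounded_iff)
  then obtain k where k: "\<And>z. K z = k" using Liouville_theorem[OF K(1)] by (auto simp: constant_on_def)
  \<comment> \<open>Constant multiples of \<open>1 + 2 * cos z\<close> vanish at all nodes and are
    bounded on the real line; the value 3 of this function at the origin excludes them.\<close>
  have "k = 0" using \<open>h 0 = 0\<close> K(2)[of 0] k by (simp add: c_def)
  thus ?thesis using K(2)[of z] k by simp
qed

lemma of_exp_type_diff:
  assumes "of_exp_type f \<sigma>" "of_exp_type g \<sigma>"
  shows "of_exp_type (\<lambda>z. f z - g z) \<sigma>"
  unfolding of_exp_type_def
proof (intro allI impI)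
  fix \<epsilon> :: real assume e: "\<epsilon> > 0"
  obtain C D where C: "C > 0" "\<And>z. norm (f z) \<le> C * exp ((\<sigma> + \<epsilon>) * norm z)"
    and D: "D > 0" "\<And>z. norm (g z) \<le> D * exp ((\<sigma> + \<epsilon>) * norm z)"
    using assms e unfolding of_exp_type_def by meson
  have "norm (f z - g z) \<le> (C + D) * exp ((\<sigma> + \<epsilon>) * norm z)" for z
    using norm_triangle_ineq4[of "f z" "g z"] C(2)[of z] D(2)[of z] by (simp add: algebra_simps)
  thus "\<exists>C>0. \<forall>z. norm (f z - g z) \<le> C * exp ((\<sigma> + \<epsilon>) * norm z)"
    using C D by (intro exI[of _ "C + D"]) auto
qed

lemma admissible_interpolant_unique:
  assumes f: "admissible_interpolant s f" and g: "admissible_interpolant s g"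
  shows "f = g"
proof
  fix z
  define h where "h = (\<lambda>z. f z - g z)"
  have h: "h holomorphic_on UNIV"
    using f g unfolding h_def admissible_interpolant_def by (intro holomorphic_intros) auto
  obtain C D where "AE x in lebesgue. norm (phi_star s x - f (of_real x)) \<le> C"
    and "AE x in lebesgue. norm (phi_star s x - g (of_real x)) \<le> D"
    using f g unfolding admissible_interpolant_def in_L_infinity_def by blast
  hence ae: "AE x in lebesgue. x \<in> {x. norm (h (of_real x)) \<le> C + D}"
  proof eventually_elim
    case (elim x)
    thus ?case
      using norm_triangle_ineq4[of "phi_star s x - g (of_real x)" "phi_star s x - f (of_real x)"]
      by (simp add: h_def)
  qed
  \<comment> \<open>In the difference \<open>phi_star\<close> cancels, so \<open>h\<close> is
    continuous and its essential bound holds on a closed set of full measure, which is the whole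
    line.\<close>
  have "continuous_on UNIV (\<lambda>x::real. h (of_real x))"
    by (intro continuous_on_compose2[OF holomorphic_on_imp_continuous_on[OF h]] continuous_intros) auto
  hence "closed {x::real. norm (h (of_real x)) \<le> C + D}"
    by (intro closed_Collect_le continuous_intros)
  from mem_closed_if_AE_lebesgue[OF this ae]
  have re: "norm (h (of_real x)) \<le> C + D" for x by simp
  have "h z = 0"
  proof (rule exp_type_1_eq_0[OF h _ re])
    show "of_exp_type h 1" using f g of_exp_type_diff unfolding h_def admissible_interpolant_def by blast
  qed (use f g in \<open>auto simp: h_def admissible_interpolant_def\<close>)
  thus "f z = g z" by (simp add: h_def)
qed

subsection \<open>Integrals over the positive half-line\<close>

text \<open>A measure of its own on the open half-line lets Fubini and dominated convergence be used
  without indicator functions, and keeps the possible singularity of the powers at 0 outside the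
  space.\<close>

definition pos_reals :: "real measure" where
  "pos_reals = restrict_space lborel {0<..}"

lemma space_pos_reals [simp]: "space pos_reals = {0<..}"
  by (simp add: pos_reals_def space_restrict_space)

lemma sigma_finite_pos_reals: "sigma_finite_measure pos_reals"
  unfolding pos_reals_def
  by (rule sigma_finite_measure_restrict_space) (auto intro: lborel.sigma_finite_measure_axioms)

lemma borel_measurable_pos_reals:
  "continuous_on {0<..} f \<Longrightarrow> f \<in> borel_measurable pos_reals"
  using borel_measurable_continuous_on_restrict[of "{0<..}" f]
  by (simp add: pos_reals_def measurable_def space_restrict_space sets_restrict_space)

text \<open>A bridge to absolute integrability in the gauge sense, the form of the Gamma integral
  and of the change of variables. Continuity supplies the Borel measurability with which one passes
  between \<open>lborel\<close> and its completion.\<close>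

lemma has_bochner_integral_pos_reals_iff:
  fixes f :: "real \<Rightarrow> 'a::euclidean_space"
  assumes "continuous_on {0<..} f"
  shows "has_bochner_integral pos_reals f I \<longleftrightarrow>
           f absolutely_integrable_on {0<..} \<and> integral {0<..} f = I"
proof -
  have meas: "(\<lambda>x. indicator {0<..} x *\<^sub>R f x) \<in> borel_measurable lborel"
    using borel_measurable_continuous_on_indicator[OF _ assms] by simp
  have "has_bochner_integral pos_reals f I \<longleftrightarrow>
          set_integrable lborel {0<..} f \<and> set_lebesgue_integral lborel {0<..} f = I"
    by (simp add: has_bochner_integral_iff pos_reals_def integrable_restrict_space
          integral_restrict_space set_integrable_def set_lebesgue_integral_def)
  also have "\<dots> \<longleftrightarrow> set_integrable lebesgue {0<..} f \<and> set_lebesgue_integral lebesgue {0<..} f = I"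
    using meas by (simp add: set_integrable_def set_lebesgue_integral_def integrable_completion integral_completion)
  also have "\<dots> \<longleftrightarrow> f absolutely_integrable_on {0<..} \<and> integral {0<..} f = I"
    using set_lebesgue_integral_eq_integral(2) by auto
  finally show ?thesis .
qed

lemma has_bochner_integral_pos_reals_cong:
  assumes "\<And>t. t > 0 \<Longrightarrow> f t = g t" "I = J"
  shows "has_bochner_integral pos_reals f I \<longleftrightarrow> has_bochner_integral pos_reals g J"
  using assms by (intro has_bochner_integral_cong) auto

lemma of_real_powr_pos: "t > 0 \<Longrightarrow> complex_of_real t powr z = exp (z * of_real (ln t))"
  by (simp add: powr_def Ln_of_real)

lemma of_real_powr_nat_shift:
  assumes "t > 0"
  shows "complex_of_real t powr (z + of_nat n) = of_real t powr z * of_real t ^ n"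
  using assms by (simp add: powr_add powr_nat)

lemma continuous_on_of_real_powr [continuous_intros]:
  "continuous_on {0<..} (\<lambda>t. complex_of_real t powr z)"
proof -
  have "continuous_on {0<..} (\<lambda>t. exp (z * complex_of_real (ln t)))"
    by (intro continuous_intros) auto
  thus ?thesis by (rule continuous_on_eq) (simp add: of_real_powr_pos)
qed

lemma norm_of_real_powr: "t > 0 \<Longrightarrow> norm (complex_of_real t powr z) = t powr Re z"
  by (simp add: norm_powr_real_powr)

lemma has_bochner_integral_change_of_variables_pos:
  fixes f :: "real \<Rightarrow> complex"
  assumes f: "has_bochner_integral pos_reals f I" "continuous_on {0<..} f"
    and g: "\<And>x. x > 0 \<Longrightarrow> (g has_field_derivative h x) (at x)" "inj_on g {0<..}" "g ` {0<..} = {0<..}"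
    and h: "continuous_on {0<..} h"
  shows "has_bochner_integral pos_reals (\<lambda>t. \<bar>h t\<bar> *\<^sub>R f (g t)) I"
proof -
  have "continuous_on {0<..} g" using g(1) by (intro DERIV_continuous_on) (auto intro: has_field_derivative_at_within)
  hence cont: "continuous_on {0<..} (\<lambda>t. \<bar>h t\<bar> *\<^sub>R f (g t))"
    using g(3) by (intro continuous_intros h continuous_on_compose2[OF f(2)]) auto
  have "(\<lambda>t. \<bar>h t\<bar> *\<^sub>R f (g t)) absolutely_integrable_on {0<..} \<and>
        integral {0<..} (\<lambda>t. \<bar>h t\<bar> *\<^sub>R f (g t)) = I"
    using f g by (subst has_absolute_integral_change_of_variables_real)
      (auto simp: has_bochner_integral_pos_reals_iff intro: has_field_derivative_at_within)
  thus ?thesis using cont by (simp add: has_bochner_integral_pos_reals_iff)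
qed

lemma has_bochner_integral_Gamma:
  assumes "Re z > 0" "a > 0"
  shows "has_bochner_integral pos_reals (\<lambda>t. of_real t powr (z - 1) * of_real (exp (- a * t)))
           (Gamma z * of_real a powr (- z))"
proof -
  have c: "continuous_on {0<..} (\<lambda>t. complex_of_real t powr (z - 1) / of_real (exp t))"
    by (intro continuous_intros) auto
  have "has_bochner_integral pos_reals (\<lambda>t. of_real t powr (z - 1) / of_real (exp t)) (Gamma z)"
    using absolutely_integrable_Gamma_integral'[OF assms(1)] Gamma_integral_complex'[OF assms(1)] c
    by (auto simp: has_bochner_integral_pos_reals_iff has_integral_iff)
  hence "has_bochner_integral pos_reals
          (\<lambda>t. \<bar>a\<bar> *\<^sub>R (of_real (a * t) powr (z - 1) / of_real (exp (a * t)))) (Gamma z)"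
  proof (rule has_bochner_integral_change_of_variables_pos[OF _ c])
    show "(*) a ` {0<..} = {0<..}"
      using assms(2) by (auto simp: image_iff intro!: bexI[of _ "x / a" for x])
  qed (use assms in \<open>auto intro!: derivative_eq_intros inj_onI\<close>)
  from has_bochner_integral_mult_left[OF this, of "of_real a powr (- z)"]
  show ?thesis
  proof (subst (asm) has_bochner_integral_pos_reals_cong)
    fix t :: real assume t: "t > 0"
    have a: "of_real a * of_real a powr (z - 1) * of_real a powr (- z) = (1 :: complex)"
      using assms(2) by (simp add: powr_diff powr_minus)
    have "(\<bar>a\<bar> *\<^sub>R (of_real (a * t) powr (z - 1) / of_real (exp (a * t)))) * of_real a powr (- z) =
       (of_real a * of_real a powr (z - 1) * of_real a powr (- z)) * (of_real t powr (z - 1) / of_real (exp (a * t)))"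
      using assms(2) t by (simp add: scaleR_conv_of_real powr_times_real)
    also have "\<dots> = of_real t powr (z - 1) * of_real (exp (- a * t))"
      unfolding a by (simp add: exp_minus exp_of_real divide_inverse)
    finally show "(\<bar>a\<bar> *\<^sub>R (of_real (a * t) powr (z - 1) / of_real (exp (a * t)))) * of_real a powr (- z) =
                  of_real t powr (z - 1) * of_real (exp (- a * t))" .
  qed auto
qed

text \<open>
  Fubini for \<open>v\<^sup>w\<^sup>-\<^sup>1 exp (- u (v + b))\<close>: integrating out \<open>u\<close> leaves the integrand below, integrating
  out \<open>v\<close> leaves the integrand of \<open>\<Gamma>(w) \<Gamma>(1 - w)\<close>.
\<close>
lemma has_bochner_integral_powr_over_add:
  assumes w: "0 < Re w" "Re w < 1" and b: "b > 0"
  shows "has_bochner_integral pos_reals (\<lambda>v. of_real v powr (w - 1) / of_real (v + b))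
           (Gamma w * Gamma (1 - w) * of_real b powr (w - 1))"
proof -
  interpret P: sigma_finite_measure pos_reals by (rule sigma_finite_pos_reals)
  interpret PP: pair_sigma_finite pos_reals pos_reals ..
  define f where "f = (\<lambda>(u, v). complex_of_real v powr (w - 1) * of_real (exp (- u * (v + b))))"
  have id: "(\<lambda>x::real. x) \<in> borel_measurable pos_reals"
    by (intro borel_measurable_pos_reals continuous_intros)
  have "(\<lambda>p. complex_of_real (snd p) powr (w - 1)) \<in> borel_measurable (pos_reals \<Otimes>\<^sub>M pos_reals)"
    by (rule measurable_compose[OF measurable_snd])
       (intro borel_measurable_pos_reals continuous_intros)
  moreover have [measurable]: "fst \<in> borel_measurable (pos_reals \<Otimes>\<^sub>M pos_reals)"
    by (rule measurable_compose[OF measurable_fst id])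
  moreover have [measurable]: "snd \<in> borel_measurable (pos_reals \<Otimes>\<^sub>M pos_reals)"
    by (rule measurable_compose[OF measurable_snd id])
  ultimately have meas: "f \<in> borel_measurable (pos_reals \<Otimes>\<^sub>M pos_reals)"
    unfolding f_def case_prod_unfold by measurable
  have inner: "has_bochner_integral pos_reals (\<lambda>v. of_real v powr (z - 1) * of_real (exp (- u * (v + b))))
                  (Gamma z * of_real u powr (- z) * of_real (exp (- b * u)))" if "u > 0" "Re z > 0" for u z
  proof (rule has_bochner_integral_pos_reals_cong[THEN iffD1, rotated -1])
    show "has_bochner_integral pos_reals
            (\<lambda>v. of_real v powr (z - 1) * of_real (exp (- u * v)) * of_real (exp (- b * u)))
            (Gamma z * of_real u powr (- z) * of_real (exp (- b * u)))"
      by (rule has_bochner_integral_mult_left[OF has_bochner_integral_Gamma[OF that(2,1)]])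
    fix v :: real
    have "exp (- u * (v + b)) = exp (- u * v) * exp (- b * u)"
      by (simp add: algebra_simps flip: exp_add)
    thus "of_real v powr (z - 1) * of_real (exp (- u * v)) * of_real (exp (- b * u)) =
          complex_of_real v powr (z - 1) * of_real (exp (- u * (v + b)))" by simp
  qed simp
  have outer: "has_bochner_integral pos_reals (\<lambda>u. Gamma z * of_real u powr (- z) * of_real (exp (- b * u)))
                 (Gamma z * Gamma (1 - z) * of_real b powr (z - 1))" if "Re z < 1" for z
    using has_bochner_integral_mult_right[OF has_bochner_integral_Gamma[of "1 - z" b], of "Gamma z"] that b
    by (simp add: mult.assoc)
  \<comment> \<open>The norm of the integrand is the same integrand with \<open>Re w\<close> in
    place of \<open>w\<close>, so the iterated integral of the norms is computed by
    \<open>inner\<close> and \<open>outer\<close> as well. This is why both are stated for a general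
    exponent.\<close>
  have normint: "(\<integral>v. norm (f (u, v)) \<partial>pos_reals) =
                   norm (Gamma (of_real (Re w)) * complex_of_real u powr (- of_real (Re w)) * of_real (exp (- b * u)))"
    if u: "u > 0" for u
  proof -
    have "has_bochner_integral pos_reals (\<lambda>v. complex_of_real (norm (f (u, v))))
       (Gamma (of_real (Re w)) * of_real u powr (- of_real (Re w)) * of_real (exp (- b * u)))"
    proof (subst has_bochner_integral_pos_reals_cong[OF _ refl])
      show "complex_of_real (norm (f (u, v))) = of_real v powr (of_real (Re w) - 1) * of_real (exp (- u * (v + b)))"
        if "v > 0" for v
        using that powr_of_real[of v "Re w - 1"] by (simp add: f_def norm_mult norm_of_real_powr)
    qed (rule inner, use u w in auto)
    hence "(\<integral>v. complex_of_real (norm (f (u, v))) \<partial>pos_reals) =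
       Gamma (of_real (Re w)) * of_real u powr (- of_real (Re w)) * of_real (exp (- b * u))"
      by (rule has_bochner_integral_integral_eq)
    hence "complex_of_real (\<integral>v. norm (f (u, v)) \<partial>pos_reals) =
       Gamma (of_real (Re w)) * of_real u powr (- of_real (Re w)) * of_real (exp (- b * u))"
      by (simp only: integral_complex_of_real)
    moreover have "(\<integral>v. norm (f (u, v)) \<partial>pos_reals) \<ge> 0" by (intro integral_nonneg_AE) auto
    ultimately show ?thesis by (simp only: norm_of_real abs_of_nonneg flip: \<open>complex_of_real _ = _\<close>)
  qed
  have int: "integrable (pos_reals \<Otimes>\<^sub>M pos_reals) f"
  proof (rule PP.Fubini_integrable[OF meas])
    show "integrable pos_reals (\<lambda>u. \<integral>v. norm (f (u, v)) \<partial>pos_reals)"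
      using integrable_norm[OF integrable.intros[OF outer[of "of_real (Re w)"]]] w normint
      by (subst Bochner_Integration.integrable_cong[OF refl]) auto
    show "AE u in pos_reals. integrable pos_reals (\<lambda>v. f (u, v))"
      using integrable.intros[OF inner[OF _ w(1)]] by (intro AE_I2) (auto simp: f_def)
  qed
  have "(\<integral>v. (\<integral>u. f (u, v) \<partial>pos_reals) \<partial>pos_reals) = (\<integral>u. (\<integral>v. f (u, v) \<partial>pos_reals) \<partial>pos_reals)"
    using PP.Fubini_integral[of "\<lambda>u v. f (u, v)"] int by simp
  also have "\<dots> = (\<integral>u. Gamma w * of_real u powr (- w) * of_real (exp (- b * u)) \<partial>pos_reals)"
    using has_bochner_integral_integral_eq[OF inner[OF _ w(1)]]
    by (intro Bochner_Integration.integral_cong refl) (auto simp: f_def)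
  also have "\<dots> = Gamma w * Gamma (1 - w) * of_real b powr (w - 1)"
    using outer[OF w(2)] by (rule has_bochner_integral_integral_eq)
  finally have eq: "(\<integral>v. (\<integral>u. f (u, v) \<partial>pos_reals) \<partial>pos_reals) = Gamma w * Gamma (1 - w) * of_real b powr (w - 1)" .
  have "integrable pos_reals (\<lambda>v. \<integral>u. f (u, v) \<partial>pos_reals)"
    using PP.integrable_snd[of "\<lambda>u v. f (u, v)"] int by simp
  with eq have "has_bochner_integral pos_reals (\<lambda>v. \<integral>u. f (u, v) \<partial>pos_reals)
                  (Gamma w * Gamma (1 - w) * of_real b powr (w - 1))"
    by (simp add: has_bochner_integral_iff)
  thus ?thesis
  proof (subst (asm) has_bochner_integral_pos_reals_cong[OF _ refl])
    fix v :: real assume v: "v > 0"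
    \<comment> \<open>The exponent \<open>1 - 1\<close> presents the integral of a pure exponential
      as the case \<open>z = 1\<close> of the Gamma integral.\<close>
    have "has_bochner_integral pos_reals (\<lambda>u. complex_of_real u powr (1 - 1) * of_real (exp (- (v + b) * u)))
            (Gamma 1 * of_real (v + b) powr (- 1))"
      using v b by (intro has_bochner_integral_Gamma) auto
    from has_bochner_integral_mult_right[OF this, of "of_real v powr (w - 1)"]
    have "has_bochner_integral pos_reals (\<lambda>u. f (u, v)) (of_real v powr (w - 1) / of_real (v + b))"
    proof (rule has_bochner_integral_pos_reals_cong[THEN iffD1, rotated -1])
      fix u :: real assume "u > 0"
      moreover have "exp (- (v + b) * u) = exp (- u * (v + b))" by (simp add: algebra_simps)
      ultimately show "of_real v powr (w - 1) * (complex_of_real u powr (1 - 1) * of_real (exp (- (v + b) * u))) = f (u, v)"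
        by (simp add: f_def)
    next
      show "of_real v powr (w - 1) * (Gamma 1 * of_real (v + b) powr (- 1)) = of_real v powr (w - 1) / of_real (v + b)"
        using v b by (simp add: powr_minus divide_inverse flip: of_real_add)
    qed
    thus "(\<integral>u. f (u, v) \<partial>pos_reals) = of_real v powr (w - 1) / of_real (v + b)"
      by (rule has_bochner_integral_integral_eq)
  qed auto
qed

lemma of_real_power2_powr:
  assumes "t > 0"
  shows "of_real (t\<^sup>2) powr (s / 2 - 1) = complex_of_real t powr (s - 2)"
proof -
  have "(s / 2 - 1) * of_real (2 * ln t) = (s - 2) * complex_of_real (ln t)"
    by (simp add: algebra_simps)
  thus ?thesis using assms by (simp add: of_real_powr_pos ln_realpow del: of_real_power of_real_mult)
qed

text \<open>Substitute \<open>v = t^2\<close> with \<open>w = s / 2\<close> and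
  \<open>b = a^2\<close>; the reflection formula turns the two Gamma factors into the sine. The
  strip for \<open>s\<close> is the range of convergence at 0 and at infinity, and it is what later
  forces the shift by \<open>2 * m1 s\<close>.\<close>

lemma has_bochner_integral_powr_over_square_add:
  assumes s: "0 < Re s" "Re s < 2" and a: "a > 0"
  shows "has_bochner_integral pos_reals (\<lambda>t. of_real t powr (s - 1) / of_real (t\<^sup>2 + a\<^sup>2))
           (of_real pi / (2 * sin (of_real pi * s / 2)) * of_real a powr (s - 2))"
proof -
  have "has_bochner_integral pos_reals
     (\<lambda>t. \<bar>2 * t\<bar> *\<^sub>R (of_real (t\<^sup>2) powr (s / 2 - 1) / of_real (t\<^sup>2 + a\<^sup>2)))
     (Gamma (s / 2) * Gamma (1 - s / 2) * of_real (a\<^sup>2) powr (s / 2 - 1))"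
  proof (rule has_bochner_integral_change_of_variables_pos[OF has_bochner_integral_powr_over_add])
    show "continuous_on {0<..} (\<lambda>v. complex_of_real v powr (s / 2 - 1) / of_real (v + a\<^sup>2))"
      using a by (intro continuous_intros) (auto simp: add_nonneg_eq_0_iff simp flip: of_real_power of_real_add)
    show "power2 ` {0<..} = {0::real<..}"
    proof (intro equalityI subsetI)
      fix x :: real assume "x \<in> {0<..}"
      thus "x \<in> power2 ` {0<..}" by (intro image_eqI[of _ _ "sqrt x"]) (simp_all add: less_imp_le)
    qed auto
  qed (use s a in \<open>auto intro!: derivative_eq_intros inj_onI continuous_intros\<close>)
  from has_bochner_integral_divide[OF this, of 2] show ?thesis
  proof (rule has_bochner_integral_pos_reals_cong[THEN iffD1, rotated -1])
    fix t :: real assume t: "t > 0"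
    have "of_real (t\<^sup>2) powr (s / 2 - 1) = complex_of_real t powr (s - 2)"
      using t by (rule of_real_power2_powr)
    moreover have "of_real t powr (s - 1) = complex_of_real t powr (s - 2) * of_real t"
      using of_real_powr_nat_shift[OF t, of "s - 2" 1] by simp
    ultimately show "\<bar>2 * t\<bar> *\<^sub>R (of_real (t\<^sup>2) powr (s / 2 - 1) / of_real (t\<^sup>2 + a\<^sup>2)) / 2 =
                     of_real t powr (s - 1) / of_real (t\<^sup>2 + a\<^sup>2)"
      using t by (simp add: scaleR_conv_of_real del: of_real_power of_real_add)
  next
    have "of_real (a\<^sup>2) powr (s / 2 - 1) = complex_of_real a powr (s - 2)"
      using a by (rule of_real_power2_powr)
    moreover have "Gamma (s / 2) * Gamma (1 - s / 2) = of_real pi / sin (of_real pi * s / 2)"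
      using Gamma_reflection_complex[of "s / 2"] by simp
    ultimately show "Gamma (s / 2) * Gamma (1 - s / 2) * of_real (a\<^sup>2) powr (s / 2 - 1) / 2 =
      of_real pi / (2 * sin (of_real pi * s / 2)) * of_real a powr (s - 2)"
      by simp
  qed
qed

subsection \<open>The kernel and its partial fractions\<close>

definition chi3_kernel :: "real \<Rightarrow> real" where
  "chi3_kernel t = 1 / (1 + 2 * cosh t)"

lemma chi3_kernel_le_exp: "chi3_kernel t \<le> exp (- t)"
proof -
  have "1 + 2 * cosh t \<ge> exp t" by (simp add: cosh_def add_increasing)
  thus ?thesis unfolding chi3_kernel_def exp_minus inverse_eq_divide by (intro divide_left_mono) (auto intro!: mult_pos_pos add_pos_pos)
qed

lemma continuous_on_chi3_kernel [continuous_intros]: "continuous_on A chi3_kernel"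
proof -
  have "1 + 2 * cosh t \<noteq> 0" for t :: real using cosh_real_pos[of t] by linarith
  thus ?thesis unfolding chi3_kernel_def[abs_def] cosh_def by (intro continuous_intros) auto
qed

text \<open>With \<open>x = exp (- t)\<close> the kernel is
  \<open>x / (1 + x + x^2) = (x - x^2) / (1 - x^3)\<close>, the generating function of the
  character: a geometric series in \<open>x^3\<close>.\<close>

lemma chi3_kernel_sums:
  assumes "t > 0"
  shows "(\<lambda>d. exp (- real (3 * d + 1) * t) - exp (- real (3 * d + 2) * t)) sums chi3_kernel t"
proof -
  define x where "x = exp (- t)"
  have x: "0 < x" "x < 1" using assms by (auto simp: x_def)
  have x3: "x ^ 3 < 1" using x by (simp add: power_less_one_iff)
  have e: "exp (- real n * t) = x ^ n" for n by (simp add: x_def flip: exp_of_nat_mult)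
  have k: "chi3_kernel t = (x - x\<^sup>2) * (1 / (1 - x ^ 3))"
  proof -
    have "exp t = 1 / x" by (simp add: x_def exp_minus field_simps)
    hence "chi3_kernel t = 1 / (1 + (1 / x + x))"
      by (simp add: chi3_kernel_def cosh_def x_def)
    also have "\<dots> = x / (1 + x + x\<^sup>2)"
      using x by (simp add: field_simps power2_eq_square)
    also have "\<dots> = (x * (1 - x)) / ((1 + x + x\<^sup>2) * (1 - x))" using x by simp
    also have "(1 + x + x\<^sup>2) * (1 - x) = 1 - x ^ 3" by (simp add: algebra_simps power2_eq_square power3_eq_cube)
    finally show ?thesis by (simp add: algebra_simps power2_eq_square)
  qed
  have "(\<lambda>d. (x - x\<^sup>2) * (x ^ 3) ^ d) sums ((x - x\<^sup>2) * (1 / (1 - x ^ 3)))"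
    using x x3 by (intro sums_mult geometric_sums) auto
  also have "(\<lambda>d. (x - x\<^sup>2) * (x ^ 3) ^ d) = (\<lambda>d. x ^ (3 * d + 1) - x ^ (3 * d + 2))"
    by (simp add: algebra_simps power2_eq_square flip: power_mult)
  finally show ?thesis unfolding e k .
qed

text \<open>The majorant is asked for the partial sums and not for the sum of the norms. A bound on
  the kernel, or on the partial sums of its paired expansion, can therefore serve directly.\<close>

lemma integral_dominated_sums:
  fixes f :: "nat \<Rightarrow> real \<Rightarrow> complex"
  assumes f: "\<And>d. has_bochner_integral pos_reals (f d) (c d)"
    and w: "integrable pos_reals w" and g: "g \<in> borel_measurable pos_reals"
    and sums: "\<And>t. t > 0 \<Longrightarrow> (\<lambda>d. f d t) sums g t"
    and bound: "\<And>n t. t > 0 \<Longrightarrow> norm (\<Sum>d<n. f d t) \<le> w t"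
  shows "integrable pos_reals g" "c sums integral\<^sup>L pos_reals g"
proof -
  have int: "integrable pos_reals (f d)" and c: "integral\<^sup>L pos_reals (f d) = c d" for d
    using f by (auto simp: has_bochner_integral_iff)
  have meas: "(\<lambda>t. \<Sum>d<n. f d t) \<in> borel_measurable pos_reals" for n
    using int by (intro borel_measurable_sum borel_measurable_integrable)
  have lim: "AE t in pos_reals. (\<lambda>n. \<Sum>d<n. f d t) \<longlonglongrightarrow> g t"
    using sums by (intro AE_I2) (auto simp: sums_def)
  have dom: "AE t in pos_reals. norm (\<Sum>d<n. f d t) \<le> w t" for n
    using bound by (intro AE_I2) auto
  show "integrable pos_reals g"
    by (rule integrable_dominated_convergence[OF g meas w lim dom])
  have "(\<lambda>n. \<integral>t. (\<Sum>d<n. f d t) \<partial>pos_reals) \<longlonglongrightarrow> integral\<^sup>L pos_reals g"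
    by (rule integral_dominated_convergence[OF g meas w lim dom])
  moreover have "(\<integral>t. (\<Sum>d<n. f d t) \<partial>pos_reals) = (\<Sum>d<n. c d)" for n
    using int by (subst Bochner_Integration.integral_sum) (auto simp: c)
  ultimately show "c sums integral\<^sup>L pos_reals g" by (simp add: sums_def)
qed

lemma integrable_Gamma_real:
  assumes "\<sigma> > 0"
  shows "integrable pos_reals (\<lambda>t. t powr (\<sigma> - 1) * exp (- t))"
proof -
  have "integrable pos_reals (\<lambda>t. norm (complex_of_real t powr (of_real \<sigma> - 1) * of_real (exp (- 1 * t))))"
    using assms by (intro integrable_norm integrable.intros[OF has_bochner_integral_Gamma]) auto
  thus ?thesis
    by (rule Bochner_Integration.integrable_cong[THEN iffD1, rotated -1])
       (auto simp: norm_mult norm_of_real_powr)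
qed

text \<open>The only zeros of the totalized \<open>Gamma\<close> are the default values 0 at its
  poles, and these lie outside the right half-plane.\<close>

lemma Gamma_nonzero_Re_pos: "Re s > 0 \<Longrightarrow> Gamma s \<noteq> 0"
  by (auto simp: Gamma_eq_zero_iff elim!: nonpos_Ints_cases')

text \<open>Pairing the residues 1 and 2 makes the real factor of each summand non-negative, so its
  partial sums stay below the kernel and hence below \<open>exp (- t)\<close>. This reaches all of
  \<open>Re s > 0\<close>, although the unpaired series converges absolutely only for
  \<open>Re s > 1\<close>.\<close>

lemma has_bochner_integral_L_chi3:
  assumes s: "Re s > 0"
  shows "has_bochner_integral pos_reals (\<lambda>t. of_real t powr (s - 1) * of_real (chi3_kernel t))
           (Gamma s * L_chi3 s)"
proof -
  define f where "f = (\<lambda>d t. of_real t powr (s - 1) *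
    complex_of_real (exp (- real (3 * d + 1) * t) - exp (- real (3 * d + 2) * t)))"
  define c where "c = (\<lambda>d. Gamma s * (of_nat (3 * d + 1) powr (- s) - of_nat (3 * d + 2) powr (- s)))"
  define g where "g = (\<lambda>t. of_real t powr (s - 1) * complex_of_real (chi3_kernel t))"
  have f: "has_bochner_integral pos_reals (f d) (c d)" for d
    using has_bochner_integral_diff[OF has_bochner_integral_Gamma[OF s, of "real (3 * d + 1)"]
        has_bochner_integral_Gamma[OF s, of "real (3 * d + 2)"]]
    by (simp add: f_def c_def algebra_simps)
  have g: "g \<in> borel_measurable pos_reals"
    unfolding g_def by (intro borel_measurable_pos_reals continuous_intros)
  have sums: "(\<lambda>d. f d t) sums g t" if "t > 0" for t
    unfolding f_def g_def by (intro sums_mult sums_of_real chi3_kernel_sums that)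
  have bound: "norm (\<Sum>d<n. f d t) \<le> t powr (Re s - 1) * exp (- t)" if t: "t > 0" for n t
  proof -
    define e where "e = (\<lambda>d. exp (- real (3 * d + 1) * t) - exp (- real (3 * d + 2) * t))"
    have e0: "e d \<ge> 0" for d using t by (simp add: e_def)
    have "(\<Sum>d<n. e d) \<le> chi3_kernel t"
      using sum_le_suminf[of e "{..<n}"] chi3_kernel_sums[OF t] e0
      by (auto simp: e_def sums_iff)
    hence "\<bar>\<Sum>d<n. e d\<bar> \<le> exp (- t)"
      using chi3_kernel_le_exp[of t] e0 by (simp add: sum_nonneg)
    moreover have "(\<Sum>d<n. f d t) = of_real t powr (s - 1) * of_real (\<Sum>d<n. e d)"
      by (simp add: f_def e_def sum_distrib_left)
    ultimately show ?thesis
      using t by (simp add: norm_mult norm_of_real_powr mult_left_mono del: of_real_sum)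
  qed
  note * = integral_dominated_sums[OF f integrable_Gamma_real[OF s] g sums bound]
  have nz: "Gamma s \<noteq> 0" using s by (rule Gamma_nonzero_Re_pos)
  have "(\<lambda>d. inverse (Gamma s) * c d) sums (inverse (Gamma s) * integral\<^sup>L pos_reals g)"
    by (intro sums_mult *)
  moreover have "inverse (Gamma s) * c d = of_nat (3 * d + 1) powr (- s) - of_nat (3 * d + 2) powr (- s)" for d
    using nz by (simp add: c_def)
  ultimately have "L_chi3 s = inverse (Gamma s) * integral\<^sup>L pos_reals g"
    by (simp add: L_chi3_def sums_iff)
  hence "integral\<^sup>L pos_reals g = Gamma s * L_chi3 s" using nz by simp
  thus ?thesis using *(1) by (simp add: has_bochner_integral_iff g_def)
qed

section \<open>Partial fractions of \<open>1 / (1 + 2 * cos z)\<close> by way of the digamma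
  function\<close>

lemma Digamma_reflection:
  fixes z :: complex
  assumes "z \<notin> \<int>"
  shows "(Digamma (1 - z) - Digamma z) * sin (of_real pi * z) = of_real pi * cos (of_real pi * z)"
proof -
  have z: "z \<notin> \<int>\<^sub>\<le>\<^sub>0" "1 - z \<notin> \<int>\<^sub>\<le>\<^sub>0"
    using assms by (metis Ints_1 Ints_diff diff_diff_eq2 add_diff_cancel_left' nonpos_Ints_Int)+
  \<comment> \<open>The product of the two reciprocal Gamma functions is
    \<open>sin (pi * w) / pi\<close>. Differentiating it in both forms expresses the digamma
    difference through the cotangent, without dividing by a sine.\<close>
  have "((\<lambda>w. rGamma w * rGamma (1 - w)) has_field_derivative
          (- rGamma z * Digamma z) * rGamma (1 - z) + (- rGamma (1 - z) * Digamma (1 - z) * - 1) * rGamma z) (at z)"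
    using z by (auto intro!: derivative_eq_intros)
  moreover have "((\<lambda>w. rGamma w * rGamma (1 - w)) has_field_derivative cos (of_real pi * z)) (at z)"
    unfolding rGamma_reflection_complex by (auto intro!: derivative_eq_intros)
  ultimately have "(- rGamma z * Digamma z) * rGamma (1 - z) + (- rGamma (1 - z) * Digamma (1 - z) * - 1) * rGamma z
     = cos (of_real pi * z)" by (rule DERIV_unique)
  hence "(Digamma (1 - z) - Digamma z) * (rGamma z * rGamma (1 - z)) = cos (of_real pi * z)"
    by (simp add: algebra_simps)
  thus ?thesis by (simp add: rGamma_reflection_complex field_simps)
qed

lemma Digamma_reflection_sums:
  fixes z :: complex
  assumes "z \<notin> \<int>"
  shows "(\<lambda>k. inverse (z + of_nat k) - inverse (1 - z + of_nat k)) sums (Digamma (1 - z) - Digamma z)"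
proof -
  have "z \<noteq> 0" "1 - z \<noteq> 0" using assms by auto
  from sums_diff[OF summable_sums[OF summable_Digamma[OF this(2)]] summable_sums[OF summable_Digamma[OF this(1)]]]
  show ?thesis by (simp add: Digamma_def)
qed


text \<open>For \<open>c = 1 / 3\<close> and \<open>c = 2 / 3\<close> these are all positive nodes,
  the second family being \<open>2 * pi * ((d + 1) - 1 / 3)\<close>.\<close>

definition node :: "real \<Rightarrow> nat \<Rightarrow> real" where
  "node c d = 2 * pi * (real d + c)"

lemma node_pos: "c > 0 \<Longrightarrow> node c d > 0"
  by (simp add: node_def add_nonneg_pos)

lemma one_plus_2cos_node [simp]:
  "1 + 2 * cos (complex_of_real (node (1 / 3) d)) = 0"
  "1 + 2 * cos (complex_of_real (node (2 / 3) d)) = 0"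
proof -
  have "node (2 / 3) d = 2 * pi * (of_int (int d + 1) - 1 / 3)" by (simp add: node_def)
  hence "node (2 / 3) d \<in> nodes" unfolding nodes_def by blast
  thus "1 + 2 * cos (complex_of_real (node (2 / 3) d)) = 0" using one_plus_2cos_eq_0_iff by blast
  have "node (1 / 3) d = 2 * pi * (of_int (int d) + 1 / 3)" by (simp add: node_def)
  hence "node (1 / 3) d \<in> nodes" unfolding nodes_def by blast
  thus "1 + 2 * cos (complex_of_real (node (1 / 3) d)) = 0" using one_plus_2cos_eq_0_iff by blast
qed

lemma square_neq_node:
  assumes "1 + 2 * cos z \<noteq> 0"
  shows "z\<^sup>2 \<noteq> (complex_of_real (node (1 / 3) d))\<^sup>2" "z\<^sup>2 \<noteq> (complex_of_real (node (2 / 3) d))\<^sup>2"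
  using assms by (auto simp: power2_eq_iff)

text \<open>The shifts \<open>x\<close> and \<open>y\<close> satisfy
  \<open>sin (pi * x) * sin (pi * y) = (1 + 2 * cos z) / 4\<close>, and
  \<open>cot (pi * x) - cot (pi * y)\<close> is \<open>sin (pi * (y - x))\<close> over that product,
  with the constant numerator \<open>- sqrt 3 / 2\<close>. In the digamma series of the two
  cotangents the four terms of index \<open>d\<close> have their poles at plus and minus the two
  nodes of index \<open>d\<close>.\<close>

lemma partial_fractions_one_plus_2cos:
  fixes z :: complex
  assumes "1 + 2 * cos z \<noteq> 0"
  shows "(\<lambda>d. 2 * of_real (node (1 / 3) d) / (z\<^sup>2 - (of_real (node (1 / 3) d))\<^sup>2)
            - 2 * of_real (node (2 / 3) d) / (z\<^sup>2 - (of_real (node (2 / 3) d))\<^sup>2))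
         sums (- of_real (sqrt 3) / (1 + 2 * cos z))"
proof -
  define x y where "x = z / (2 * of_real pi) + 2 / 3" and "y = z / (2 * of_real pi) + 1 / 3"
  have xy: "of_real pi * x = z / 2 + of_real (2 * pi / 3)" "of_real pi * y = z / 2 + of_real (pi / 3)"
    by (simp_all add: x_def y_def field_simps)
  have c3: "cos (complex_of_real (pi / 3)) = 1 / 2" "sin (complex_of_real (pi / 3)) = of_real (sqrt 3) / 2"
    unfolding cos_of_real sin_of_real by (simp_all add: cos_60 sin_60)
  have prod: "sin (of_real pi * x) * sin (of_real pi * y) = (1 + 2 * cos z) / 4"
  proof -
    have "sin (of_real pi * x) * sin (of_real pi * y) =
       (cos (of_real pi * x - of_real pi * y) - cos (of_real pi * x + of_real pi * y)) / 2"
      by (rule sin_times_sin)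
    also have "of_real pi * x - of_real pi * y = complex_of_real (pi / 3)" by (simp add: xy)
    also have "of_real pi * x + of_real pi * y = z + of_real pi" by (simp add: xy)
    finally show ?thesis by (simp only: c3) (simp add: cos_add field_simps)
  qed
  have nz: "sin (of_real pi * x) \<noteq> 0" "sin (of_real pi * y) \<noteq> 0"
    using prod assms by (metis div_by_0 mult_zero_left mult_zero_right divide_eq_0_iff zero_neq_numeral)+
  have "x \<notin> \<int>" "y \<notin> \<int>"
    using nz by (auto elim!: Ints_cases simp: sin_eq_0 mult.commute)
  note D = Digamma_reflection[OF \<open>x \<notin> \<int>\<close>] Digamma_reflection[OF \<open>y \<notin> \<int>\<close>]
  have val: "(Digamma (1 - x) - Digamma x) - (Digamma (1 - y) - Digamma y) =
               - 2 * of_real pi * of_real (sqrt 3) / (1 + 2 * cos z)"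
  proof -
    have "((Digamma (1 - x) - Digamma x) - (Digamma (1 - y) - Digamma y)) *
            (sin (of_real pi * x) * sin (of_real pi * y)) =
          ((Digamma (1 - x) - Digamma x) * sin (of_real pi * x)) * sin (of_real pi * y) -
          ((Digamma (1 - y) - Digamma y) * sin (of_real pi * y)) * sin (of_real pi * x)"
      by (simp add: algebra_simps)
    also have "\<dots> = of_real pi * (sin (of_real pi * y) * cos (of_real pi * x) - cos (of_real pi * y) * sin (of_real pi * x))"
      unfolding D by (simp add: algebra_simps)
    also have "sin (of_real pi * y) * cos (of_real pi * x) - cos (of_real pi * y) * sin (of_real pi * x) =
               sin (of_real pi * y - of_real pi * x)" by (simp add: sin_diff)
    also have "of_real pi * y - of_real pi * x = - complex_of_real (pi / 3)" by (simp add: xy)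
    finally show ?thesis unfolding prod sin_minus c3 using assms by (simp add: field_simps)
  qed
  have trm: "(inverse (x + of_nat d) - inverse (1 - x + of_nat d)) - (inverse (y + of_nat d) - inverse (1 - y + of_nat d)) =
     2 * of_real pi * (2 * of_real (node (1 / 3) d) / (z\<^sup>2 - (of_real (node (1 / 3) d))\<^sup>2)
            - 2 * of_real (node (2 / 3) d) / (z\<^sup>2 - (of_real (node (2 / 3) d))\<^sup>2))" for d
  proof -
    define a b where "a = complex_of_real (node (1 / 3) d)" and "b = complex_of_real (node (2 / 3) d)"
    have ab: "z\<^sup>2 \<noteq> a\<^sup>2" "z\<^sup>2 \<noteq> b\<^sup>2"
      unfolding a_def b_def using square_neq_node[OF assms] by blast+
    hence ne: "z + a \<noteq> 0" "z - a \<noteq> 0" "z + b \<noteq> 0" "z - b \<noteq> 0" "a - z \<noteq> 0" "b - z \<noteq> 0"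
      by (auto simp: power2_eq_iff add_eq_0_iff2)
    have eqs: "x + of_nat d = (z + b) / (2 * of_real pi)" "1 - x + of_nat d = (a - z) / (2 * of_real pi)"
      "y + of_nat d = (z + a) / (2 * of_real pi)" "1 - y + of_nat d = (b - z) / (2 * of_real pi)"
      by (simp_all add: x_def y_def a_def b_def node_def field_simps)
    have "(inverse (x + of_nat d) - inverse (1 - x + of_nat d)) - (inverse (y + of_nat d) - inverse (1 - y + of_nat d)) =
       2 * of_real pi * ((1 / (z + b) - 1 / (a - z)) - (1 / (z + a) - 1 / (b - z)))"
      unfolding eqs inverse_divide by (simp add: right_diff_distrib)
    also have "(1 / (z + b) - 1 / (a - z)) - (1 / (z + a) - 1 / (b - z)) =
       (1 / (z - a) - 1 / (z + a)) - (1 / (z - b) - 1 / (z + b))"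
    proof -
      have "1 / (a - z) = - (1 / (z - a))" "1 / (b - z) = - (1 / (z - b))"
        by (metis minus_diff_eq minus_divide_right)+
      thus ?thesis by (simp only:) simp
    qed
    also have "1 / (z - a) - 1 / (z + a) = 2 * a / (z\<^sup>2 - a\<^sup>2)"
      using ne by (simp add: diff_frac_eq power2_eq_square algebra_simps)
    also have "1 / (z - b) - 1 / (z + b) = 2 * b / (z\<^sup>2 - b\<^sup>2)"
      using ne by (simp add: diff_frac_eq power2_eq_square algebra_simps)
    finally show ?thesis unfolding a_def b_def .
  qed
  have "(\<lambda>d. 2 * of_real pi * (2 * of_real (node (1 / 3) d) / (z\<^sup>2 - (of_real (node (1 / 3) d))\<^sup>2)
            - 2 * of_real (node (2 / 3) d) / (z\<^sup>2 - (of_real (node (2 / 3) d))\<^sup>2)))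
         sums (- 2 * of_real pi * of_real (sqrt 3) / (1 + 2 * cos z))"
    using sums_diff[OF Digamma_reflection_sums[OF \<open>x \<notin> \<int>\<close>] Digamma_reflection_sums[OF \<open>y \<notin> \<int>\<close>]]
    unfolding trm val .
  from sums_divide[OF this, of "2 * of_real pi"] show ?thesis by simp
qed

lemma chi3_kernel_partial_fractions:
  "(\<lambda>d. 2 * node (1 / 3) d / (t\<^sup>2 + (node (1 / 3) d)\<^sup>2) - 2 * node (2 / 3) d / (t\<^sup>2 + (node (2 / 3) d)\<^sup>2))
     sums (sqrt 3 * chi3_kernel t)"
proof -
  define z where "z = \<i> * complex_of_real t"
  have cz: "1 + 2 * cos z = of_real (1 + 2 * cosh t)"
    by (simp add: z_def cosh_field_def flip: cosh_conv_cos exp_of_real)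
  have q: "2 * of_real a / (z\<^sup>2 - (of_real a)\<^sup>2) = - complex_of_real (2 * a / (t\<^sup>2 + a\<^sup>2))" for a
  proof -
    have z2: "z\<^sup>2 - (of_real a)\<^sup>2 = - complex_of_real (t\<^sup>2 + a\<^sup>2)"
      by (simp add: z_def power_mult_distrib)
    show ?thesis unfolding z2 by (simp only: divide_minus_right of_real_divide of_real_mult of_real_numeral)
  qed
  have "1 + 2 * cosh t > 0" using cosh_real_pos[of t] by linarith
  hence "1 + 2 * cos z \<noteq> 0" unfolding cz of_real_eq_0_iff by linarith
  from sums_minus[OF partial_fractions_one_plus_2cos[OF this]]
  have "(\<lambda>d. complex_of_real (2 * node (1 / 3) d / (t\<^sup>2 + (node (1 / 3) d)\<^sup>2) - 2 * node (2 / 3) d / (t\<^sup>2 + (node (2 / 3) d)\<^sup>2)))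
     sums complex_of_real (sqrt 3 * chi3_kernel t)"
    unfolding cz q by (simp add: chi3_kernel_def)
  thus ?thesis by (simp only: sums_of_real_iff)
qed

subsection \<open>The cosine quotients and their series\<close>

lemma norm_sin_le_exp_Im: "norm (sin z) \<le> exp \<bar>Im z\<bar>" for z :: complex
proof -
  have "norm (sin z) = norm (exp (\<i> * z) - exp (- (\<i> * z))) / 2"
    by (simp add: sin_exp_eq norm_divide norm_mult)
  also have "\<dots> \<le> (norm (exp (\<i> * z)) + norm (exp (- (\<i> * z)))) / 2"
    by (intro divide_right_mono norm_triangle_ineq4) auto
  also have "\<dots> = (exp (- Im z) + exp (Im z)) / 2" by simp
  also have "\<dots> \<le> (exp \<bar>Im z\<bar> + exp \<bar>Im z\<bar>) / 2"
    by (intro divide_right_mono add_mono) auto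
  finally show ?thesis by simp
qed

lemma norm_one_plus_2cos_le: "norm (1 + 2 * cos z) \<le> 3 * exp (norm z)" for z :: complex
proof -
  have "norm (1 + 2 * cos z) \<le> 1 + 2 * norm (cos z)"
    using norm_triangle_ineq[of 1 "2 * cos z"] by simp
  also have "\<dots> \<le> 1 + 2 * exp (norm z)" using norm_cos_le[of z] by simp
  also have "\<dots> \<le> 3 * exp (norm z)" using one_le_exp_iff[of "norm z"] by simp
  finally show ?thesis .
qed

text \<open>A mean value estimate in the horizontal strip
  \<open>\<bar>Im w\<bar> \<le> \<bar>Im z\<bar>\<close>, which is convex and contains both
  \<open>z\<close> and the real point \<open>a\<close>. It controls the cosine quotient where its
  denominator is small.\<close>

lemma norm_one_plus_2cos_le_diff:
  fixes z :: complex
  assumes "1 + 2 * cos (of_real a) = (0 :: complex)"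
  shows "norm (1 + 2 * cos z) \<le> 2 * exp (norm z) * norm (z - of_real a)"
proof -
  define S where "S = {w. \<bar>Im w\<bar> \<le> \<bar>Im z\<bar>}"
  have "convex S"
  proof -
    have "S = {w. Im w \<le> \<bar>Im z\<bar>} \<inter> {w. Im w \<ge> - \<bar>Im z\<bar>}" by (auto simp: S_def)
    thus ?thesis using convex_halfspace_Im_le convex_halfspace_Im_ge convex_Int by metis
  qed
  hence "norm ((1 + 2 * cos z) - (1 + 2 * cos (of_real a))) \<le> 2 * exp (norm z) * norm (z - of_real a)"
  proof (rule field_differentiable_bound)
    fix w assume "w \<in> S"
    hence "\<bar>Im w\<bar> \<le> norm z" using abs_Im_le_cmod[of z] by (auto simp: S_def)
    thus "norm (- 2 * sin w) \<le> 2 * exp (norm z)"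
      using norm_sin_le_exp_Im[of w] by (simp add: norm_mult) (meson exp_le_cancel_iff order_trans)
  qed (auto simp: S_def intro!: derivative_eq_intros)
  thus ?thesis using assms by simp
qed

context
  fixes a :: real
  assumes a: "a > 0" and zero: "1 + 2 * cos (complex_of_real a) = 0"
begin

text \<open>Since \<open>a > 0\<close>, the denominator has the two distinct simple zeros
  \<open>a\<close> and \<open>- a\<close>, where the even numerator vanishes too. The entire
  quotient is then the limit that \<open>remove_sings\<close> takes at every point.\<close>

lemma cos_quotient_entire:
  "cos_quotient a holomorphic_on UNIV" "cos_quotient a z * (z\<^sup>2 - (of_real a)\<^sup>2) = 1 + 2 * cos z"
proof -
  define c where "c = (\<lambda>z. z\<^sup>2 - (complex_of_real a)\<^sup>2)"
  have c0: "c z = 0 \<longleftrightarrow> z = of_real a \<or> z = - of_real a" for z by (auto simp: c_def power2_eq_iff)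
  have "deriv c z = 2 * z" for z unfolding c_def by (auto intro!: DERIV_imp_deriv derivative_eq_intros)
  hence dc: "deriv c z \<noteq> 0" if "c z = 0" for z using that a by (auto simp: c0)
  have "1 + 2 * cos z = 0" if "c z = 0" for z using that zero by (auto simp: c0)
  moreover have "(\<lambda>z::complex. 1 + 2 * cos z) holomorphic_on UNIV" "c holomorphic_on UNIV"
    unfolding c_def by (intro holomorphic_intros)+
  ultimately obtain K where K: "K holomorphic_on UNIV" "\<And>z. 1 + 2 * cos z = K z * c z"
    using entire_quotient[of "\<lambda>z. 1 + 2 * cos z" c] dc by blast
  have "cos_quotient a z = K z" for z
    unfolding cos_quotient_def
  proof (rule remove_sings_eqI)
    have "(K \<longlongrightarrow> K z) (at z)"
      using K(1) by (metis UNIV_I at_within_open holomorphic_on_imp_continuous_on continuous_on_def open_UNIV)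
    moreover have "eventually (\<lambda>w. w \<noteq> of_real a \<and> w \<noteq> - of_real a) (at z)"
      by (intro eventually_conj eventually_neq_at_within)
    hence "eventually (\<lambda>w. K w = (1 + 2 * cos w) / (w\<^sup>2 - (of_real a)\<^sup>2)) (at z)"
      by eventually_elim (use c0 in \<open>auto simp: K(2) c_def\<close>)
    ultimately show "((\<lambda>w. (1 + 2 * cos w) / (w\<^sup>2 - (of_real a)\<^sup>2)) \<longlongrightarrow> K z) (at z)"
      by (rule Lim_transform_eventually)
  qed
  thus "cos_quotient a holomorphic_on UNIV" "cos_quotient a z * (z\<^sup>2 - (of_real a)\<^sup>2) = 1 + 2 * cos z"
    using K unfolding c_def by (auto cong: holomorphic_cong)
qed

text \<open>Differentiate the product identity of \<open>cos_quotient_entire\<close> at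
  \<open>z\<close>: the factor that vanishes there leaves only
  \<open>cos_quotient a z * (2 * z) = - 2 * sin z\<close>.\<close>

lemma cos_quotient_at:
  assumes "z = of_real a \<or> z = - of_real a"
  shows "cos_quotient a z = - of_real (sin a) / of_real a"
proof -
  have "(cos_quotient a has_field_derivative deriv (cos_quotient a) z) (at z)"
    using cos_quotient_entire(1) by (rule holomorphic_derivI) auto
  hence "((\<lambda>w. cos_quotient a w * (w\<^sup>2 - (of_real a)\<^sup>2)) has_field_derivative cos_quotient a z * (2 * z)) (at z)"
    using assms by (auto intro!: derivative_eq_intros)
  moreover have "((\<lambda>w. 1 + 2 * cos w) has_field_derivative - 2 * sin z) (at z)"
    by (auto intro!: derivative_eq_intros)
  ultimately have "cos_quotient a z * (2 * z) = - 2 * sin z"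
    unfolding cos_quotient_entire(2) by (rule DERIV_unique)
  moreover have "2 * z * of_real (sin a) = 2 * of_real a * sin z"
    using assms by (auto simp: sin_of_real)
  moreover have "(cos_quotient a z * of_real a + of_real (sin a)) * (2 * z) =
      of_real a * (cos_quotient a z * (2 * z)) + 2 * z * of_real (sin a)"
    by (simp add: algebra_simps)
  ultimately have "(cos_quotient a z * of_real a + of_real (sin a)) * (2 * z) = 0"
    by (simp only:) simp
  moreover have "z \<noteq> 0" using assms a by auto
  ultimately have "cos_quotient a z * of_real a = - of_real (sin a)"
    by (simp add: add_eq_0_iff2)
  thus ?thesis using a by (simp add: field_simps)
qed

lemma cos_quotient_minus: "cos_quotient a (- z) = cos_quotient a z"
proof (cases "z\<^sup>2 = (of_real a)\<^sup>2")
  case True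
  hence "z = of_real a \<or> z = - of_real a" by (simp add: power2_eq_iff)
  thus ?thesis using cos_quotient_at[of z] cos_quotient_at[of "- z"] by auto
next
  case False
  have "cos_quotient a (- z) * (z\<^sup>2 - (of_real a)\<^sup>2) = cos_quotient a z * (z\<^sup>2 - (of_real a)\<^sup>2)"
    using cos_quotient_entire(2)[of "- z"] cos_quotient_entire(2)[of z] by simp
  thus ?thesis using False by simp
qed

text \<open>The decay \<open>1 / a^2\<close> is what makes the series over the nodes converge. For
  \<open>norm z \<le> a / 2\<close> the denominator is at least \<open>3 / 4 * a^2\<close>.
  Otherwise each of the distances of \<open>z\<close> from \<open>a\<close> and \<open>- a\<close>
  times the quotient is at most \<open>2 * exp (norm z)\<close>, and the distances add up to at
  least \<open>2 * a\<close>; this gives decay \<open>1 / a\<close>, and the missing factor is paid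
  by \<open>a < 2 * norm z\<close>.\<close>

lemma norm_cos_quotient_le: "norm (cos_quotient a z) \<le> 4 * (1 + norm z) * exp (norm z) / a\<^sup>2"
proof (cases "norm z \<le> a / 2")
  case True
  hence "(norm z)\<^sup>2 \<le> (a / 2)\<^sup>2" by (intro power_mono) auto
  hence "3 / 4 * a\<^sup>2 \<le> norm (z\<^sup>2 - (of_real a)\<^sup>2)"
    using norm_triangle_ineq2[of "(complex_of_real a)\<^sup>2" "z\<^sup>2"]
    by (simp add: norm_power norm_minus_commute power_divide)
  hence "norm (cos_quotient a z) * (3 / 4 * a\<^sup>2) \<le> norm (cos_quotient a z) * norm (z\<^sup>2 - (of_real a)\<^sup>2)"
    by (intro mult_left_mono) auto
  also have "\<dots> = norm (1 + 2 * cos z)" by (simp only: cos_quotient_entire(2) flip: norm_mult)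
  also have "\<dots> \<le> 3 * exp (norm z)" by (rule norm_one_plus_2cos_le)
  finally have "norm (cos_quotient a z) \<le> 4 * 1 * exp (norm z) / a\<^sup>2" using a by (simp add: field_simps)
  also have "\<dots> \<le> 4 * (1 + norm z) * exp (norm z) / a\<^sup>2"
    by (intro divide_right_mono mult_right_mono) auto
  finally show ?thesis .
next
  case False
  have "norm (cos_quotient a z) \<le> 2 * exp (norm z) / a"
  proof (cases "z = of_real a \<or> z = - of_real a")
    case True
    have "norm (cos_quotient a z) \<le> 1 / a"
      unfolding cos_quotient_at[OF True] using a by (simp add: norm_divide divide_right_mono)
    also have "\<dots> \<le> 2 * exp (norm z) / a"
    proof -
      have "1 \<le> exp (norm z)" by simp
      thus ?thesis using a by (intro divide_right_mono) linarith+
    qed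
    finally show ?thesis .
  next
    case False
    hence ne: "z - of_real a \<noteq> 0" "z + of_real a \<noteq> 0" by (auto simp: add_eq_0_iff2)
    have q: "norm (cos_quotient a z) * (norm (z - of_real a) * norm (z + of_real a)) = norm (1 + 2 * cos z)"
    proof -
      have "(z - of_real a) * (z + of_real a) = z\<^sup>2 - (of_real a)\<^sup>2"
        by (simp add: algebra_simps power2_eq_square)
      thus ?thesis by (simp only: cos_quotient_entire(2) flip: norm_mult)
    qed
    have "norm (1 + 2 * cos z) \<le> 2 * exp (norm z) * norm (z - of_real a)"
      by (rule norm_one_plus_2cos_le_diff[OF zero])
    hence 1: "norm (cos_quotient a z) * norm (z + of_real a) \<le> 2 * exp (norm z)"
      unfolding q[symmetric] using ne by (simp add: mult_ac)
    have "norm (1 + 2 * cos z) \<le> 2 * exp (norm z) * norm (z - of_real (- a))"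
      by (rule norm_one_plus_2cos_le_diff) (use zero in simp)
    hence 2: "norm (cos_quotient a z) * norm (z - of_real a) \<le> 2 * exp (norm z)"
      unfolding q[symmetric] using ne by (simp add: mult_ac)
    have "2 * a \<le> norm (z + of_real a) + norm (z - of_real a)"
      using norm_triangle_ineq4[of "z + of_real a" "z - of_real a"] a by (simp add: norm_mult flip: of_real_add)
    hence "norm (cos_quotient a z) * (2 * a) \<le> norm (cos_quotient a z) * (norm (z + of_real a) + norm (z - of_real a))"
      by (intro mult_left_mono) auto
    also have "\<dots> \<le> 4 * exp (norm z)" using 1 2 by (simp add: distrib_left)
    finally show ?thesis using a by (simp add: field_simps)
  qed
  also have "\<dots> \<le> 4 * (1 + norm z) * exp (norm z) / a\<^sup>2"
  proof -
    have "2 * a * exp (norm z) \<le> 4 * (1 + norm z) * exp (norm z)"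
      using False by (intro mult_right_mono) auto
    hence "2 * a * exp (norm z) / a\<^sup>2 \<le> 4 * (1 + norm z) * exp (norm z) / a\<^sup>2"
      by (rule divide_right_mono) simp
    thus ?thesis using a by (simp add: power2_eq_square)
  qed
  finally show ?thesis .
qed

end

section \<open>The series over one family of nodes\<close>

lemma summable_node_powr:
  assumes "c > 0" "p > 1"
  shows "summable (\<lambda>d. node c d powr - p)"
proof (rule summable_comparison_test_ev)
  show "summable (\<lambda>d. real d powr - p)" using assms by (simp add: summable_real_powr_iff)
  show "eventually (\<lambda>d. norm (node c d powr - p) \<le> real d powr - p) sequentially"
    using eventually_gt_at_top[of 0]
  proof eventually_elim
    case (elim d)
    have "1 * real d \<le> (2 * pi) * (real d + c)" using assms pi_gt3 by (intro mult_mono) auto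
    hence "real d \<le> node c d" by (simp add: node_def)
    thus ?case using elim assms by (auto intro!: powr_mono2')
  qed
qed

definition cos_series :: "real \<Rightarrow> complex \<Rightarrow> complex \<Rightarrow> complex" where
  "cos_series c p z = (\<Sum>d. of_real (node c d) powr p * cos_quotient (node c d) z)"

context
  fixes c :: real and p :: complex
  assumes c: "c \<in> {1 / 3, 2 / 3}" and p: "Re p < 1"
begin

lemma node_pos_zero: "node c d > 0" "1 + 2 * cos (complex_of_real (node c d)) = 0"
proof -
  show "node c d > 0" using c by (intro node_pos) auto
  show "1 + 2 * cos (complex_of_real (node c d)) = 0"
    using c by (elim insertE) (simp_all only: one_plus_2cos_node empty_iff)
qed

lemma norm_cos_series_term_le:
  "norm (of_real (node c d) powr p * cos_quotient (node c d) z) \<le>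
     4 * (1 + norm z) * exp (norm z) * node c d powr - (2 - Re p)"
proof -
  have "norm (of_real (node c d) powr p * cos_quotient (node c d) z) \<le>
          node c d powr Re p * (4 * (1 + norm z) * exp (norm z) / (node c d)\<^sup>2)"
    unfolding norm_mult norm_of_real_powr[OF node_pos_zero(1)]
    by (intro mult_left_mono norm_cos_quotient_le node_pos_zero) auto
  also have "\<dots> = 4 * (1 + norm z) * exp (norm z) * node c d powr - (2 - Re p)"
    using node_pos_zero(1)[of d] by (simp add: powr_diff powr_minus field_simps)
  finally show ?thesis .
qed

lemma summable_node_powr_Re: "summable (\<lambda>d. node c d powr - (2 - Re p))"
  using c p by (intro summable_node_powr) auto

lemma summable_cos_series: "summable (\<lambda>d. of_real (node c d) powr p * cos_quotient (node c d) z)"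
  by (rule summable_comparison_test[OF _ summable_mult[OF summable_node_powr_Re]])
     (use norm_cos_series_term_le in blast)

lemma cos_series_holomorphic: "cos_series c p holomorphic_on UNIV"
proof (rule holomorphic_uniform_sequence)
  show "(\<lambda>z. \<Sum>d<n. of_real (node c d) powr p * cos_quotient (node c d) z) holomorphic_on UNIV" for n
    by (intro holomorphic_intros cos_quotient_entire node_pos_zero)
  fix z :: complex
  have "uniform_limit (cball z 1) (\<lambda>n z. \<Sum>d<n. of_real (node c d) powr p * cos_quotient (node c d) z)
          (cos_series c p) sequentially"
    unfolding cos_series_def[abs_def]
  proof (rule Weierstrass_m_test)
    show "summable (\<lambda>d. 4 * (1 + (norm z + 1)) * exp (norm z + 1) * node c d powr - (2 - Re p))"
      by (intro summable_mult summable_node_powr_Re)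
    fix d w assume "w \<in> cball z 1"
    hence w: "norm w \<le> norm z + 1" using norm_triangle_ineq2[of w z] by (simp add: dist_norm norm_minus_commute)
    have "4 * (1 + norm w) * exp (norm w) * node c d powr - (2 - Re p) \<le>
          4 * (1 + (norm z + 1)) * exp (norm z + 1) * node c d powr - (2 - Re p)"
      using w by (intro mult_mono) auto
    thus "norm (of_real (node c d) powr p * cos_quotient (node c d) w) \<le>
          4 * (1 + (norm z + 1)) * exp (norm z + 1) * node c d powr - (2 - Re p)"
      using norm_cos_series_term_le[of d w] by linarith
  qed
  thus "\<exists>r>0. cball z r \<subseteq> UNIV \<and> uniform_limit (cball z r)
      (\<lambda>n z. \<Sum>d<n. of_real (node c d) powr p * cos_quotient (node c d) z) (cos_series c p) sequentially"
    by (intro exI[of _ 1]) auto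
qed auto

lemma norm_cos_series_le:
  "norm (cos_series c p z) \<le> 4 * (\<Sum>d. node c d powr - (2 - Re p)) * ((1 + norm z) * exp (norm z))"
proof -
  have "norm (cos_series c p z) \<le> (\<Sum>d. 4 * (1 + norm z) * exp (norm z) * node c d powr - (2 - Re p))"
    unfolding cos_series_def
    by (intro norm_suminf_le norm_cos_series_term_le summable_mult summable_node_powr_Re)
  also have "\<dots> = 4 * (1 + norm z) * exp (norm z) * (\<Sum>d. node c d powr - (2 - Re p))"
    by (rule suminf_mult[OF summable_node_powr_Re])
  finally show ?thesis by (simp add: algebra_simps)
qed

lemma cos_series_minus: "cos_series c p (- z) = cos_series c p z"
  unfolding cos_series_def using node_pos_zero by (simp add: cos_quotient_minus)

lemma cos_series_at_zero:
  assumes "1 + 2 * cos z = 0" "\<And>d. z\<^sup>2 \<noteq> (of_real (node c d))\<^sup>2"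
  shows "cos_series c p z = 0"
proof -
  have "cos_quotient (node c d) z = 0" for d
    using cos_quotient_entire(2)[OF node_pos_zero, of d z] assms by simp
  thus ?thesis by (simp add: cos_series_def)
qed

text \<open>The numerator \<open>1 + 2 * cos z\<close> vanishes at the node and kills every term
  except the one of index \<open>k\<close>, whose denominator vanishes as well.\<close>

lemma cos_series_at_node:
  assumes "z = of_real (node c k) \<or> z = - of_real (node c k)"
  shows "cos_series c p z = - of_real (sin (node c k)) * of_real (node c k) powr (p - 1)"
proof -
  have z0: "1 + 2 * cos z = 0" using assms node_pos_zero(2)[of k] by auto
  have "cos_quotient (node c d) z = 0" if "d \<noteq> k" for d
  proof -
    have "node c d \<noteq> node c k" using that by (simp add: node_def)
    hence "(node c k)\<^sup>2 \<noteq> (node c d)\<^sup>2" using node_pos_zero(1)[of d] node_pos_zero(1)[of k] by (simp add: power2_eq_iff)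
    hence "(complex_of_real (node c k))\<^sup>2 \<noteq> (of_real (node c d))\<^sup>2" by (metis of_real_eq_iff of_real_power)
    hence "z\<^sup>2 \<noteq> (of_real (node c d))\<^sup>2" using assms by auto
    thus ?thesis using cos_quotient_entire(2)[OF node_pos_zero, of d z] z0 by simp
  qed
  hence eq: "(\<lambda>d. of_real (node c d) powr p * cos_quotient (node c d) z) =
     (\<lambda>d. if d = k then of_real (node c k) powr p * cos_quotient (node c k) z else 0)"
    by auto
  hence "cos_series c p z = of_real (node c k) powr p * cos_quotient (node c k) z"
    unfolding cos_series_def eq
    using sums_unique[OF sums_single[of k "\<lambda>_. of_real (node c k) powr p * cos_quotient (node c k) z"]] by simp
  also have "\<dots> = - of_real (sin (node c k)) * of_real (node c k) powr (p - 1)"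
    using node_pos_zero(1)[of k] unfolding cos_quotient_at[OF node_pos_zero assms]
    by (simp add: powr_diff field_simps)
  finally show ?thesis .
qed

end

section \<open>Closure properties of exponential type\<close>

lemma of_exp_typeI:
  assumes "\<And>\<epsilon>. \<epsilon> > 0 \<Longrightarrow> \<exists>C. \<forall>z. norm (g z) \<le> C * exp ((\<sigma> + \<epsilon>) * norm z)"
  shows "of_exp_type g \<sigma>"
  unfolding of_exp_type_def
proof (intro allI impI)
  fix \<epsilon> :: real assume "\<epsilon> > 0"
  then obtain C where C: "\<And>z. norm (g z) \<le> C * exp ((\<sigma> + \<epsilon>) * norm z)" using assms by blast
  have "norm (g z) \<le> (\<bar>C\<bar> + 1) * exp ((\<sigma> + \<epsilon>) * norm z)" for z
    using C[of z] by (rule order_trans) (intro mult_right_mono, auto)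
  thus "\<exists>C>0. \<forall>z. norm (g z) \<le> C * exp ((\<sigma> + \<epsilon>) * norm z)"
    by (intro exI[of _ "\<bar>C\<bar> + 1"]) auto
qed

lemma of_exp_type_const: "of_exp_type (\<lambda>_. c) 0"
proof (rule of_exp_typeI, intro exI allI)
  fix \<epsilon> :: real and z :: complex assume "\<epsilon> > 0"
  thus "norm c \<le> norm c * exp ((0 + \<epsilon>) * norm z)" by (simp add: mult_le_cancel_left1)
qed

lemma of_exp_type_ident: "of_exp_type (\<lambda>z. z) 0"
proof (rule of_exp_typeI, intro exI allI)
  fix \<epsilon> :: real and z :: complex assume e: "\<epsilon> > 0"
  have "\<epsilon> * norm z \<le> exp (\<epsilon> * norm z)" using exp_ge_add_one_self[of "\<epsilon> * norm z"] by linarith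
  thus "norm z \<le> 1 / \<epsilon> * exp ((0 + \<epsilon>) * norm z)" using e by (simp add: field_simps)
qed

lemma of_exp_type_add:
  assumes "of_exp_type f \<sigma>" "of_exp_type g \<sigma>"
  shows "of_exp_type (\<lambda>z. f z + g z) \<sigma>"
proof -
  have "of_exp_type (\<lambda>z. - g z) \<sigma>" using assms(2) by (simp add: of_exp_type_def)
  from of_exp_type_diff[OF assms(1) this] show ?thesis by simp
qed

lemma of_exp_type_mult:
  assumes f: "of_exp_type f \<sigma>" and g: "of_exp_type g \<tau>"
  shows "of_exp_type (\<lambda>z. f z * g z) (\<sigma> + \<tau>)"
proof (rule of_exp_typeI)
  fix \<epsilon> :: real assume "\<epsilon> > 0"
  hence "\<epsilon> / 2 > 0" by simp
  then obtain C D where C: "C > 0" "\<And>z. norm (f z) \<le> C * exp ((\<sigma> + \<epsilon> / 2) * norm z)"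
    and D: "D > 0" "\<And>z. norm (g z) \<le> D * exp ((\<tau> + \<epsilon> / 2) * norm z)"
    using f g unfolding of_exp_type_def by meson
  have "norm (f z * g z) \<le> (C * D) * exp ((\<sigma> + \<tau> + \<epsilon>) * norm z)" for z
  proof -
    have "norm (f z * g z) \<le> (C * exp ((\<sigma> + \<epsilon> / 2) * norm z)) * (D * exp ((\<tau> + \<epsilon> / 2) * norm z))"
      unfolding norm_mult using C D by (intro mult_mono) (auto intro: less_imp_le)
    also have "\<dots> = (C * D) * exp ((\<sigma> + \<tau> + \<epsilon>) * norm z)"
      by (simp add: algebra_simps flip: exp_add)
    finally show ?thesis .
  qed
  thus "\<exists>C. \<forall>z. norm (f z * g z) \<le> C * exp ((\<sigma> + \<tau> + \<epsilon>) * norm z)" by blast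
qed

lemma of_exp_type_power: "of_exp_type (\<lambda>z. z ^ n) 0"
proof (induction n)
  case (Suc n)
  show ?case using of_exp_type_mult[OF of_exp_type_ident Suc] by simp
qed (simp add: of_exp_type_const)

lemma of_exp_type_sum:
  assumes "\<And>i. i \<in> A \<Longrightarrow> of_exp_type (f i) 0"
  shows "of_exp_type (\<lambda>z. \<Sum>i\<in>A. f i z) 0"
  using assms by (induction A rule: infinite_finite_induct)
    (auto intro: of_exp_type_const of_exp_type_add)

lemma of_exp_type_one_plus_2cos: "of_exp_type (\<lambda>z. 1 + 2 * cos z) 1"
proof (rule of_exp_typeI, intro exI allI)
  fix \<epsilon> :: real and z :: complex assume "\<epsilon> > 0"
  hence "3 * exp (norm z) \<le> 3 * exp ((1 + \<epsilon>) * norm z)" by (simp add: distrib_right)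
  thus "norm (1 + 2 * cos z) \<le> 3 * exp ((1 + \<epsilon>) * norm z)"
    using norm_one_plus_2cos_le[of z] by linarith
qed

lemma of_exp_type_cos_series:
  assumes "c \<in> {1 / 3, 2 / 3}" "Re p < 1"
  shows "of_exp_type (cos_series c p) 1"
proof (rule of_exp_typeI, intro exI allI)
  fix \<epsilon> :: real and z :: complex assume e: "\<epsilon> > 0"
  define C where "C = 4 * (\<Sum>d. node c d powr - (2 - Re p))"
  have C0: "C \<ge> 0" unfolding C_def using summable_node_powr_Re[OF assms] by (simp add: suminf_nonneg)
  \<comment> \<open>The linear factor \<open>1 + norm z\<close> of the bound is absorbed into
    \<open>exp (\<epsilon> * norm z)\<close> at the price of the constant
    \<open>1 + 1 / \<epsilon>\<close>.\<close>
  have "\<epsilon> * norm z \<le> exp (\<epsilon> * norm z)" using exp_ge_add_one_self[of "\<epsilon> * norm z"] by linarith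
  hence "norm z \<le> 1 / \<epsilon> * exp (\<epsilon> * norm z)" using e by (simp add: field_simps)
  moreover have "1 \<le> exp (\<epsilon> * norm z)" using e by simp
  ultimately have "1 + norm z \<le> (1 + 1 / \<epsilon>) * exp (\<epsilon> * norm z)"
    unfolding distrib_right mult_1_left by (intro add_mono)
  hence "(1 + norm z) * exp (norm z) \<le> ((1 + 1 / \<epsilon>) * exp (\<epsilon> * norm z)) * exp (norm z)"
    by (intro mult_right_mono) auto
  also have "\<dots> = (1 + 1 / \<epsilon>) * exp ((1 + \<epsilon>) * norm z)"
    by (simp add: algebra_simps flip: exp_add)
  finally have "C * ((1 + norm z) * exp (norm z)) \<le> C * ((1 + 1 / \<epsilon>) * exp ((1 + \<epsilon>) * norm z))"
    using C0 by (rule mult_left_mono)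
  thus "norm (cos_series c p z) \<le> (C * (1 + 1 / \<epsilon>)) * exp ((1 + \<epsilon>) * norm z)"
    using norm_cos_series_le[OF assms, of z] by (simp add: C_def mult.assoc)
qed

subsection \<open>The integral representation\<close>

lemma node_less: "node (1 / 3) d < node (2 / 3) d"
  by (simp add: node_def)

lemma of_real_mult_powr_pos:
  "a > 0 \<Longrightarrow> complex_of_real a * of_real a powr z = of_real a powr (z + 1)"
  by (simp add: powr_add)

text \<open>Partial fractions in \<open>t^2\<close> reduce the product of the two denominators to a
  difference of two integrals already known. The power of \<open>a\<close> becomes a term of the
  interpolant, the power of \<open>y\<close> a contribution to \<open>phi_star\<close>.\<close>

lemma has_bochner_integral_powr_two_squares:
  assumes s: "0 < Re s" "Re s < 2" and "a > 0" "y > 0" "y\<^sup>2 \<noteq> a\<^sup>2"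
  shows "has_bochner_integral pos_reals
    (\<lambda>t. of_real t powr (s - 1) * of_real (y\<^sup>2 / (y\<^sup>2 + t\<^sup>2) * (2 * a / (t\<^sup>2 + a\<^sup>2))))
    (of_real pi / (2 * sin (of_real pi * s / 2)) *
      (2 * (of_real y)\<^sup>2 * (of_real a powr (s - 1) / ((of_real y)\<^sup>2 - (of_real a)\<^sup>2))
       - of_real y powr s * (2 * of_real a / ((of_real y)\<^sup>2 - (of_real a)\<^sup>2))))"
    (is "has_bochner_integral _ ?f (?K * ?V)")
proof -
  define D where "D = complex_of_real (y\<^sup>2 - a\<^sup>2)"
  have D: "D \<noteq> 0" "(of_real y)\<^sup>2 - (of_real a)\<^sup>2 = D" using assms(5) unfolding D_def of_real_eq_0_iff by simp_all
  have "has_bochner_integral pos_reals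
    (\<lambda>t. (of_real (2 * a * y\<^sup>2) / D) * (of_real t powr (s - 1) / of_real (t\<^sup>2 + a\<^sup>2) - of_real t powr (s - 1) / of_real (t\<^sup>2 + y\<^sup>2)))
    ((of_real (2 * a * y\<^sup>2) / D) * (?K * of_real a powr (s - 2) - ?K * of_real y powr (s - 2)))"
    using assms by (intro has_bochner_integral_mult_right has_bochner_integral_diff has_bochner_integral_powr_over_square_add)
  thus ?thesis
  proof (rule has_bochner_integral_pos_reals_cong[THEN iffD1, rotated -1])
    fix t :: real assume t: "t > 0"
    have p: "t\<^sup>2 + a\<^sup>2 > 0" "y\<^sup>2 + t\<^sup>2 > 0" using t by (auto simp: add_pos_nonneg add_nonneg_pos)
    hence ne: "t\<^sup>2 + a\<^sup>2 \<noteq> 0" "y\<^sup>2 + t\<^sup>2 \<noteq> 0" by linarith+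
    have "1 / (t\<^sup>2 + a\<^sup>2) - 1 / (t\<^sup>2 + y\<^sup>2) = (y\<^sup>2 - a\<^sup>2) / ((t\<^sup>2 + a\<^sup>2) * (y\<^sup>2 + t\<^sup>2))"
      unfolding add.commute[of "t\<^sup>2" "y\<^sup>2"] diff_frac_eq[OF ne] by simp
    hence "y\<^sup>2 / (y\<^sup>2 + t\<^sup>2) * (2 * a / (t\<^sup>2 + a\<^sup>2)) =
       (2 * a * y\<^sup>2 / (y\<^sup>2 - a\<^sup>2)) * (1 / (t\<^sup>2 + a\<^sup>2) - 1 / (t\<^sup>2 + y\<^sup>2))"
      using assms(5) by (simp add: mult_ac)
    hence e: "complex_of_real (y\<^sup>2 / (y\<^sup>2 + t\<^sup>2) * (2 * a / (t\<^sup>2 + a\<^sup>2))) =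
       (of_real (2 * a * y\<^sup>2) / D) * (1 / of_real (t\<^sup>2 + a\<^sup>2) - 1 / of_real (t\<^sup>2 + y\<^sup>2))"
      by (simp only: D_def of_real_mult of_real_divide of_real_diff of_real_1)
    show "(of_real (2 * a * y\<^sup>2) / D) * (of_real t powr (s - 1) / of_real (t\<^sup>2 + a\<^sup>2) - of_real t powr (s - 1) / of_real (t\<^sup>2 + y\<^sup>2)) = ?f t"
      unfolding e by (simp only: divide_inverse right_diff_distrib mult_1_left mult_ac)
  next
    have "complex_of_real a powr (s - 1) = of_real a * of_real a powr (s - 2)"
      using of_real_mult_powr_pos[OF \<open>a > 0\<close>, of "s - 2"] by simp
    moreover have "complex_of_real y powr s = (of_real y)\<^sup>2 * of_real y powr (s - 2)"
      using of_real_powr_nat_shift[OF \<open>y > 0\<close>, of "s - 2" 2] by (simp add: mult.commute)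
    ultimately have "?V = (of_real (2 * a * y\<^sup>2) / D) * (of_real a powr (s - 2) - of_real y powr (s - 2))"
      unfolding D(2) using D(1) by (simp add: diff_divide_distrib[symmetric] field_simps)
    thus "(of_real (2 * a * y\<^sup>2) / D) * (?K * of_real a powr (s - 2) - ?K * of_real y powr (s - 2)) = ?K * ?V"
      by (simp only:) (simp only: right_diff_distrib mult_ac)
  qed
qed

text \<open>Each of the two fractions is only of order \<open>1 / a\<close> for large nodes; their
  difference is of order \<open>1 / a^2\<close>, uniformly in \<open>t\<close>. The constant
  \<open>4 * pi / 3\<close> is twice the distance of the paired nodes.\<close>

lemma node_term_bound:
  "\<bar>2 * node (1 / 3) d / (t\<^sup>2 + (node (1 / 3) d)\<^sup>2) - 2 * node (2 / 3) d / (t\<^sup>2 + (node (2 / 3) d)\<^sup>2)\<bar>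
     \<le> 4 * pi / 3 * node (1 / 3) d powr - 2"
proof -
  define a b where "a = node (1 / 3) d" and "b = node (2 / 3) d"
  have ab: "0 < a" "0 < b" "a \<le> b" "b - a = 2 * pi / 3"
    using node_less[of d] by (auto simp: a_def b_def node_pos) (simp add: node_def field_simps)
  have ta: "t\<^sup>2 + a\<^sup>2 > 0" and tb: "t\<^sup>2 + b\<^sup>2 > 0" using ab by (auto simp: add_nonneg_pos)
  have "2 * a / (t\<^sup>2 + a\<^sup>2) - 2 * b / (t\<^sup>2 + b\<^sup>2) = 2 * (b - a) * (a * b - t\<^sup>2) / ((t\<^sup>2 + a\<^sup>2) * (t\<^sup>2 + b\<^sup>2))"
  proof -
    have ne: "t\<^sup>2 + a\<^sup>2 \<noteq> 0" "t\<^sup>2 + b\<^sup>2 \<noteq> 0" using ta tb by linarith+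
    have "2 * a * (t\<^sup>2 + b\<^sup>2) - 2 * b * (t\<^sup>2 + a\<^sup>2) = 2 * (b - a) * (a * b - t\<^sup>2)"
      by (simp add: algebra_simps power2_eq_square)
    thus ?thesis by (simp only: diff_frac_eq[OF ne])
  qed
  \<comment> \<open>Bounding the numerator by a multiple of \<open>t^2 + b^2\<close> cancels one
    factor of the denominator and leaves a bound that is largest at \<open>t = 0\<close>.\<close>
  moreover have "\<bar>2 * (b - a) * (a * b - t\<^sup>2)\<bar> \<le> 2 * (b - a) * (t\<^sup>2 + b\<^sup>2)"
  proof -
    have "0 \<le> a * b" "a * b \<le> b\<^sup>2" using ab by (auto simp: power2_eq_square intro: mult_right_mono)
    hence "\<bar>a * b - t\<^sup>2\<bar> \<le> t\<^sup>2 + b\<^sup>2" using zero_le_power2[of t] by linarith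
    moreover have "\<bar>2 * (b - a)\<bar> = 2 * (b - a)" using ab(3) by simp
    ultimately show ?thesis
      unfolding abs_mult[of "2 * (b - a)"] using ab(3) by (simp only:) (intro mult_left_mono, auto)
  qed
  ultimately have "\<bar>2 * a / (t\<^sup>2 + a\<^sup>2) - 2 * b / (t\<^sup>2 + b\<^sup>2)\<bar> \<le> 2 * (b - a) * (t\<^sup>2 + b\<^sup>2) / ((t\<^sup>2 + a\<^sup>2) * (t\<^sup>2 + b\<^sup>2))"
    using mult_pos_pos[OF ta tb] by (simp only: abs_divide abs_of_pos) (rule divide_right_mono, auto)
  also have "\<dots> = 2 * (b - a) / (t\<^sup>2 + a\<^sup>2)"
    using tb by (intro nonzero_mult_divide_mult_cancel_right) linarith
  also have "\<dots> \<le> 2 * (b - a) / a\<^sup>2" using ab ta by (intro divide_left_mono) auto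
  also have "\<dots> = 4 * pi / 3 * a powr - 2"
  proof -
    have "a powr - 2 = 1 / a\<^sup>2" using ab by (simp add: powr_minus_divide)
    thus ?thesis unfolding ab(4) by simp
  qed
  finally show ?thesis unfolding a_def b_def .
qed

text \<open>Summed over the index, the powers of the nodes form the two cosine series divided by
  \<open>1 + 2 * cos y\<close>, while the coefficients of \<open>y powr s\<close> are the partial
  fractions at \<open>z = y\<close> and add up to a multiple of \<open>1 / (1 + 2 * cos y)\<close>.
  The factor \<open>sqrt 3\<close> from the expansion of the kernel is divided out at the
  end.\<close>

lemma integral_chi3_kernel_base:
  assumes s: "0 < Re s" "Re s < 2" and y: "y > 0" and D: "1 + 2 * cos (complex_of_real y) \<noteq> 0"
  shows "has_bochner_integral pos_reals
    (\<lambda>t. of_real t powr (s - 1) * of_real (y\<^sup>2 / (y\<^sup>2 + t\<^sup>2) * chi3_kernel t))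
    (of_real pi / (2 * sin (of_real pi * s / 2)) / (1 + 2 * cos (of_real y)) *
      (of_real y powr s + 2 / of_real (sqrt 3) * (of_real y)\<^sup>2 *
        (cos_series (1 / 3) (s - 1) (of_real y) - cos_series (2 / 3) (s - 1) (of_real y))))"
    (is "has_bochner_integral _ ?g _")
proof -
  define K where "K = of_real pi / (2 * sin (of_real pi * s / 2))"
  define E where "E = 1 + 2 * cos (complex_of_real y)"
  define r3 where "r3 = complex_of_real (sqrt 3)"
  define Y where "Y = complex_of_real y"
  define A B where "A = cos_series (1 / 3) (s - 1) (of_real y)" and "B = cos_series (2 / 3) (s - 1) (of_real y)"
  have r3: "r3 \<noteq> 0" by (simp add: r3_def)
  have E: "E \<noteq> 0" using D by (simp add: E_def)
  define V where "V = (\<lambda>c d. K * (2 * Y\<^sup>2 * (of_real (node c d) powr (s - 1) / (Y\<^sup>2 - (of_real (node c d))\<^sup>2))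
       - Y powr s * (2 * of_real (node c d) / (Y\<^sup>2 - (of_real (node c d))\<^sup>2))))"
  define e where "e = (\<lambda>d t. 2 * node (1 / 3) d / (t\<^sup>2 + (node (1 / 3) d)\<^sup>2) - 2 * node (2 / 3) d / (t\<^sup>2 + (node (2 / 3) d)\<^sup>2))"
  define f where "f = (\<lambda>d t. of_real t powr (s - 1) * complex_of_real (y\<^sup>2 / (y\<^sup>2 + t\<^sup>2) * e d t))"
  define g where "g = (\<lambda>t. of_real t powr (s - 1) * complex_of_real (y\<^sup>2 / (y\<^sup>2 + t\<^sup>2) * (sqrt 3 * chi3_kernel t)))"
  define S where "S = (\<Sum>d. 4 * pi / 3 * node (1 / 3) d powr - 2)"
  have sumS: "summable (\<lambda>d. 4 * pi / 3 * node (1 / 3) d powr - 2)"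
    by (intro summable_mult summable_node_powr) auto
  have nodeY: "Y\<^sup>2 \<noteq> (of_real (node (1 / 3) d))\<^sup>2" "Y\<^sup>2 \<noteq> (of_real (node (2 / 3) d))\<^sup>2" for d
    unfolding Y_def using square_neq_node[OF D] by blast+
  have f: "has_bochner_integral pos_reals (f d) (V (1 / 3) d - V (2 / 3) d)" for d
  proof -
    have ne: "y\<^sup>2 \<noteq> (node (1 / 3) d)\<^sup>2" "y\<^sup>2 \<noteq> (node (2 / 3) d)\<^sup>2"
      using nodeY[of d] unfolding Y_def by (metis of_real_power)+
    have "has_bochner_integral pos_reals
      (\<lambda>t. of_real t powr (s - 1) * of_real (y\<^sup>2 / (y\<^sup>2 + t\<^sup>2) * (2 * node (1 / 3) d / (t\<^sup>2 + (node (1 / 3) d)\<^sup>2))) -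
           of_real t powr (s - 1) * of_real (y\<^sup>2 / (y\<^sup>2 + t\<^sup>2) * (2 * node (2 / 3) d / (t\<^sup>2 + (node (2 / 3) d)\<^sup>2))))
      (V (1 / 3) d - V (2 / 3) d)"
      unfolding V_def K_def Y_def
      by (intro has_bochner_integral_diff has_bochner_integral_powr_two_squares s y ne node_pos) auto
    also have "(\<lambda>t. of_real t powr (s - 1) * of_real (y\<^sup>2 / (y\<^sup>2 + t\<^sup>2) * (2 * node (1 / 3) d / (t\<^sup>2 + (node (1 / 3) d)\<^sup>2))) -
           of_real t powr (s - 1) * of_real (y\<^sup>2 / (y\<^sup>2 + t\<^sup>2) * (2 * node (2 / 3) d / (t\<^sup>2 + (node (2 / 3) d)\<^sup>2)))) = f d"
      unfolding f_def e_def by (simp only: right_diff_distrib of_real_diff)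
    finally show ?thesis .
  qed
  have cont: "continuous_on {0<..} (\<lambda>t. complex_of_real (y\<^sup>2 / (y\<^sup>2 + t\<^sup>2) * (c * chi3_kernel t)))" for c
    using y by (intro continuous_intros) (auto simp: add_nonneg_eq_0_iff)
  have g: "g \<in> borel_measurable pos_reals"
    unfolding g_def by (intro borel_measurable_pos_reals continuous_on_mult cont continuous_on_of_real_powr)
  have sums: "(\<lambda>d. f d t) sums g t" for t
    unfolding f_def g_def e_def by (intro sums_mult sums_of_real chi3_kernel_partial_fractions)
  \<comment> \<open>\<open>S\<close> bounds all partial sums of the paired expansion uniformly in
    \<open>t\<close>, so a multiple of \<open>t powr (Re s - 1) / (t^2 + y^2)\<close> serves as
    majorant, integrable in this strip.\<close>
  have w: "integrable pos_reals (\<lambda>t. (S * y\<^sup>2) * norm (of_real t powr (s - 1) / complex_of_real (t\<^sup>2 + y\<^sup>2)))"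
    using s y by (intro integrable_mult_right integrable_norm integrable.intros[OF has_bochner_integral_powr_over_square_add])
  have bound: "norm (\<Sum>d<n. f d t) \<le> (S * y\<^sup>2) * norm (of_real t powr (s - 1) / complex_of_real (t\<^sup>2 + y\<^sup>2))" for n t
  proof -
    have "\<bar>\<Sum>d<n. e d t\<bar> \<le> (\<Sum>d<n. 4 * pi / 3 * node (1 / 3) d powr - 2)"
      unfolding e_def by (rule order_trans[OF sum_abs sum_mono]) (rule node_term_bound)
    also have "\<dots> \<le> S" unfolding S_def by (intro sum_le_suminf sumS) auto
    finally have *: "\<bar>\<Sum>d<n. e d t\<bar> \<le> S" .
    have pos: "t\<^sup>2 + y\<^sup>2 > 0" using y by (simp add: add_nonneg_pos)
    have "(\<Sum>d<n. f d t) = of_real t powr (s - 1) * of_real (y\<^sup>2 / (y\<^sup>2 + t\<^sup>2) * (\<Sum>d<n. e d t))"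
      unfolding f_def by (simp only: sum_distrib_left of_real_sum)
    hence "norm (\<Sum>d<n. f d t) = norm (complex_of_real t powr (s - 1)) * (y\<^sup>2 / (t\<^sup>2 + y\<^sup>2) * \<bar>\<Sum>d<n. e d t\<bar>)"
      using pos by (simp add: norm_mult abs_mult add.commute del: of_real_sum of_real_mult of_real_divide of_real_power of_real_add)
    also have "\<dots> \<le> norm (complex_of_real t powr (s - 1)) * (y\<^sup>2 / (t\<^sup>2 + y\<^sup>2) * S)"
      using pos * by (intro mult_left_mono) auto
    also have "\<dots> = (S * y\<^sup>2) * norm (of_real t powr (s - 1) / complex_of_real (t\<^sup>2 + y\<^sup>2))"
      using pos by (simp add: norm_divide del: of_real_add of_real_power)
    finally show ?thesis .
  qed
  note main = integral_dominated_sums[OF f w g sums bound]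
  have cs: "(\<lambda>d. of_real (node c d) powr (s - 1) / (Y\<^sup>2 - (of_real (node c d))\<^sup>2)) sums (cos_series c (s - 1) Y / E)"
    if c: "c \<in> {1 / 3, 2 / 3}" for c
  proof -
    have Re: "Re (s - 1) < 1" using s by simp
    have "(\<lambda>d. of_real (node c d) powr (s - 1) * cos_quotient (node c d) Y / E) sums (cos_series c (s - 1) Y / E)"
      unfolding cos_series_def by (intro sums_divide summable_sums summable_cos_series c Re)
    also have "(\<lambda>d. of_real (node c d) powr (s - 1) * cos_quotient (node c d) Y / E) =
               (\<lambda>d. of_real (node c d) powr (s - 1) / (Y\<^sup>2 - (of_real (node c d))\<^sup>2))"
    proof
      fix d
      have ne: "Y\<^sup>2 - (of_real (node c d))\<^sup>2 \<noteq> 0"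
        using nodeY[of d] c by (elim insertE) (simp_all only: right_minus_eq empty_iff not_False_eq_True)
      have "cos_quotient (node c d) Y * (Y\<^sup>2 - (of_real (node c d))\<^sup>2) = E"
        using cos_quotient_entire(2)[OF node_pos_zero[OF c Re], of d Y] by (simp only: E_def Y_def)
      thus "of_real (node c d) powr (s - 1) * cos_quotient (node c d) Y / E =
            of_real (node c d) powr (s - 1) / (Y\<^sup>2 - (of_real (node c d))\<^sup>2)"
        using ne E by (simp add: frac_eq_eq mult.assoc)
    qed
    finally show ?thesis .
  qed
  have "(\<lambda>d. K * (2 * Y\<^sup>2 * (of_real (node (1 / 3) d) powr (s - 1) / (Y\<^sup>2 - (of_real (node (1 / 3) d))\<^sup>2)
                           - of_real (node (2 / 3) d) powr (s - 1) / (Y\<^sup>2 - (of_real (node (2 / 3) d))\<^sup>2))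
       - Y powr s * (2 * of_real (node (1 / 3) d) / (Y\<^sup>2 - (of_real (node (1 / 3) d))\<^sup>2)
                     - 2 * of_real (node (2 / 3) d) / (Y\<^sup>2 - (of_real (node (2 / 3) d))\<^sup>2))))
     sums (K * (2 * Y\<^sup>2 * (A / E - B / E) - Y powr s * (- r3 / E)))"
    unfolding A_def B_def E_def r3_def Y_def
    by (intro sums_mult sums_diff partial_fractions_one_plus_2cos D cs[unfolded E_def Y_def]) auto
  also have "(\<lambda>d. K * (2 * Y\<^sup>2 * (of_real (node (1 / 3) d) powr (s - 1) / (Y\<^sup>2 - (of_real (node (1 / 3) d))\<^sup>2)
                           - of_real (node (2 / 3) d) powr (s - 1) / (Y\<^sup>2 - (of_real (node (2 / 3) d))\<^sup>2))
       - Y powr s * (2 * of_real (node (1 / 3) d) / (Y\<^sup>2 - (of_real (node (1 / 3) d))\<^sup>2)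
                     - 2 * of_real (node (2 / 3) d) / (Y\<^sup>2 - (of_real (node (2 / 3) d))\<^sup>2))))
     = (\<lambda>d. V (1 / 3) d - V (2 / 3) d)"
    unfolding V_def by (simp only: right_diff_distrib) (simp only: algebra_simps)
  finally have "integral\<^sup>L pos_reals g = K * (2 * Y\<^sup>2 * (A / E - B / E) - Y powr s * (- r3 / E))"
    using main(2) by (metis sums_unique2)
  hence "has_bochner_integral pos_reals g (K * (2 * Y\<^sup>2 * (A / E - B / E) - Y powr s * (- r3 / E)))"
    using main(1) by (simp add: has_bochner_integral_iff)
  from has_bochner_integral_mult_right[OF this, of "1 / r3"] show ?thesis
  proof (rule has_bochner_integral_pos_reals_cong[THEN iffD1, rotated -1])
    show "1 / r3 * g t = ?g t" for t
      using r3 by (simp add: g_def r3_def)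
    have "1 / r3 * (K * (2 * Y\<^sup>2 * (A / E - B / E) - Y powr s * (- r3 / E))) =
          K / E * (Y powr s + 2 / r3 * Y\<^sup>2 * (A - B))"
      using r3 E by (simp add: field_simps)
    thus "1 / r3 * (K * (2 * Y\<^sup>2 * (A / E - B / E) - Y powr s * (- r3 / E))) =
       of_real pi / (2 * sin (of_real pi * s / 2)) / (1 + 2 * cos (of_real y)) *
      (of_real y powr s + 2 / of_real (sqrt 3) * (of_real y)\<^sup>2 *
        (cos_series (1 / 3) (s - 1) (of_real y) - cos_series (2 / 3) (s - 1) (of_real y)))"
      by (simp only: K_def E_def r3_def Y_def A_def B_def)
  qed
qed

text \<open>The hypothesis holds for \<open>x = y^2 / t^2\<close> and
  \<open>q = x / (1 + x) = y^2 / (y^2 + t^2)\<close>. Inserting it into itself \<open>m\<close>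
  times splits off \<open>m\<close> powers of \<open>x\<close>, and the same weight \<open>q\<close>
  remains in the last term.\<close>

lemma geometric_split:
  fixes q x :: real
  assumes "q = x - x * q"
  shows "q = (\<Sum>j=1..m. (- 1) ^ (j - 1) * x ^ j) + (- 1) ^ m * x ^ m * q"
proof (induction m)
  case (Suc m)
  define c where "c = (- 1) ^ m * x ^ m"
  have "c * q = c * x - c * x * q"
    using arg_cong[OF assms, of "(*) c"] by (simp add: right_diff_distrib mult.assoc)
  moreover have "(\<Sum>j=1..Suc m. (- 1) ^ (j - 1) * x ^ j) = (\<Sum>j=1..m. (- 1) ^ (j - 1) * x ^ j) + c * x"
    by (simp add: c_def)
  moreover have "(- 1) ^ Suc m * x ^ Suc m * q = - (c * x * q)" by (simp add: c_def)
  ultimately show ?case using Suc.IH unfolding c_def by linarith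
qed simp

text \<open>Lowering \<open>s\<close> by \<open>2 * m\<close> moves \<open>pi * s / 2\<close> by
  \<open>m * pi\<close>. The resulting sign cancels the sign of the geometric remainder, so no power
  of -1 is left in front of the series of \<open>gamma_star\<close>.\<close>

lemma sin_minus_nat_pi: "sin (z - of_real pi * of_nat m) = (- 1) ^ m * sin (z :: complex)"
proof (induction m)
  case (Suc m)
  have "sin (z - of_real pi * of_nat (Suc m)) = sin ((z - of_real pi * of_nat m) - of_real pi)"
    by (simp add: algebra_simps)
  also have "\<dots> = - sin (z - of_real pi * of_nat m)" by (simp add: sin_diff)
  finally show ?case using Suc by simp
qed simp

lemma three_powr_minus_half: "3 powr (s - 1 / 2) = 3 powr s / complex_of_real (sqrt 3)"
proof -
  have "complex_of_real 3 powr of_real (1 / 2) = of_real (3 powr (1 / 2))" by (rule powr_of_real) simp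
  hence "(3 :: complex) powr (1 / 2) = of_real (sqrt 3)" by (simp add: powr_half_sqrt)
  thus ?thesis by (simp add: powr_diff)
qed

lemma phi_star_eq:
  "phi_star s y = of_real pi * 3 powr s * of_real \<bar>y\<bar> powr s / (2 * sin (of_real pi * s / 2))"
  by (simp add: phi_star_def powr_times_real)

lemma phi_star_abs: "phi_star s \<bar>y\<bar> = phi_star s y"
  by (simp add: phi_star_def)

definition chi3_integral :: "complex \<Rightarrow> real \<Rightarrow> complex" where
  "chi3_integral s y = (\<integral>t. of_real t powr (s - 1) * of_real (y\<^sup>2 / (y\<^sup>2 + t\<^sup>2) * chi3_kernel t) \<partial>pos_reals)"

text \<open>This is \<open>s' - 1\<close> for the reduced parameter
  \<open>s' = s - 2 * m1 s\<close>. For the values of \<open>s\<close> considered,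
  \<open>0 < Re s' < 2\<close>, so its real part is below 1, as the convergence of the cosine series
  asks.\<close>

definition residual_exponent :: "complex \<Rightarrow> complex" where
  "residual_exponent s = s - of_nat (2 * m1 s) - 1"

definition polynomial_part :: "complex \<Rightarrow> complex \<Rightarrow> complex" where
  "polynomial_part s z = (\<Sum>j = 1..m1 s. (- 1) ^ (j - 1) * Gamma (s - of_nat (2 * j)) *
             L_chi3 (s - of_nat (2 * j)) * z ^ (2 * j))"

lemma gamma_star_eq:
  "gamma_star s z = (1 + 2 * cos z) * (- (3 powr s) * polynomial_part s z)
     + of_real pi * 3 powr (s - 1 / 2) * z ^ (2 * (m1 s + 1)) / sin (of_real pi * s / 2) *
       (- cos_series (1 / 3) (residual_exponent s) z + cos_series (2 / 3) (residual_exponent s) z)"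
  unfolding gamma_star_def cos_series_def residual_exponent_def polynomial_part_def node_def ..

context
  fixes s :: complex
  assumes pos: "Re s > 0" and not_even: "\<And>k::nat. k \<ge> 1 \<Longrightarrow> Re s \<noteq> 2 * real k"
begin

lemma m1_bounds: "2 * real (m1 s) < Re s" "Re s < 2 * real (m1 s) + 2"
proof -
  have fl: "real (m1 s) = of_int \<lfloor>Re s / 2\<rfloor>" using pos by (simp add: m1_def)
  have "of_int \<lfloor>Re s / 2\<rfloor> \<le> Re s / 2" "Re s / 2 < of_int \<lfloor>Re s / 2\<rfloor> + 1" by linarith+
  \<comment> \<open>The floor gives only a weak lower inequality; the excluded even values make it
    strict, and for \<open>m1 s = 0\<close> positivity of \<open>Re s\<close> does.\<close>
  moreover have "Re s \<noteq> 2 * real (m1 s)" using pos not_even[of "m1 s"] by (cases "m1 s") auto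
  ultimately show "2 * real (m1 s) < Re s" "Re s < 2 * real (m1 s) + 2" unfolding fl by linarith+
qed

lemma Re_residual_exponent: "Re (residual_exponent s) < 1"
  using m1_bounds by (simp add: residual_exponent_def)

text \<open>The powers of \<open>y^2 / t^2\<close> split off from the weight give Gamma integrals
  for \<open>L_chi3\<close> at \<open>s - 2 * j\<close>, where the real part is still positive
  because \<open>j \<le> m1 s\<close>; they form the polynomial part. The remainder is the formula
  for the base strip at \<open>s' = s - 2 * m1 s\<close>, multiplied by
  \<open>y ^ (2 * m1 s)\<close>.\<close>

lemma chi3_integral_representation:
  assumes y: "y > 0" and D: "1 + 2 * cos (complex_of_real y) \<noteq> 0"
  shows "phi_star s y - gamma_star s (of_real y) =
           3 powr s * (1 + 2 * cos (of_real y)) * chi3_integral s y"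
proof -
  define m where "m = m1 s"
  define s' where "s' = s - of_nat (2 * m)"
  define Y where "Y = complex_of_real y"
  define E where "E = 1 + 2 * cos Y"
  define K where "K = of_real pi / (2 * sin (of_real pi * s / 2))"
  define A B where "A = cos_series (1 / 3) (s' - 1) Y" and "B = cos_series (2 / 3) (s' - 1) Y"
  define r3 where "r3 = complex_of_real (sqrt 3)"
  have r3: "r3 \<noteq> 0" by (simp add: r3_def)
  have E: "E \<noteq> 0" using D by (simp add: E_def Y_def)
  have s': "0 < Re s'" "Re s' < 2" using m1_bounds by (auto simp: s'_def m_def)
  have powr_shift: "complex_of_real t powr (s - 1) = of_real t powr (s - of_nat (2 * j) - 1) * of_real t ^ (2 * j)"
    if "t > 0" for t j
    using of_real_powr_nat_shift[OF that, of "s - of_nat (2 * j) - 1" "2 * j"] by (simp add: algebra_simps)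
  define f where "f = (\<lambda>j t. (- 1) ^ (j - 1) * Y ^ (2 * j) *
     (of_real t powr (s - of_nat (2 * j) - 1) * of_real (chi3_kernel t)))"
  define g where "g = (\<lambda>t. (- 1) ^ m * Y ^ (2 * m) *
     (of_real t powr (s' - 1) * of_real (y\<^sup>2 / (y\<^sup>2 + t\<^sup>2) * chi3_kernel t)))"
  define c where "c = (\<lambda>j. (- 1) ^ (j - 1) * Y ^ (2 * j) * (Gamma (s - of_nat (2 * j)) * L_chi3 (s - of_nat (2 * j))))"
  define G where "G = of_real pi / (2 * sin (of_real pi * s' / 2)) / E * (Y powr s' + 2 / r3 * Y\<^sup>2 * (A - B))"
  have f: "has_bochner_integral pos_reals (f j) (c j)" if "j \<in> {1..m}" for j
  proof -
    have "Re (s - of_nat (2 * j)) > 0" using that m1_bounds(1) by (simp add: m_def)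
    thus ?thesis unfolding f_def c_def
      by (intro has_bochner_integral_mult_right has_bochner_integral_L_chi3)
  qed
  have g: "has_bochner_integral pos_reals g ((- 1) ^ m * Y ^ (2 * m) * G)"
    unfolding g_def G_def A_def B_def E_def Y_def r3_def
    by (intro has_bochner_integral_mult_right integral_chi3_kernel_base s' y D)
  have "has_bochner_integral pos_reals (\<lambda>t. (\<Sum>j=1..m. f j t) + g t) ((\<Sum>j=1..m. c j) + (- 1) ^ m * Y ^ (2 * m) * G)"
    by (intro has_bochner_integral_add has_bochner_integral_sum f g)
  hence "has_bochner_integral pos_reals (\<lambda>t. of_real t powr (s - 1) * of_real (y\<^sup>2 / (y\<^sup>2 + t\<^sup>2) * chi3_kernel t))
     ((\<Sum>j=1..m. c j) + (- 1) ^ m * Y ^ (2 * m) * G)"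
  proof (rule has_bochner_integral_pos_reals_cong[THEN iffD1, rotated -1])
    fix t :: real assume t: "t > 0"
    define q x where "q = y\<^sup>2 / (y\<^sup>2 + t\<^sup>2)" and "x = y\<^sup>2 / t\<^sup>2"
    have yt: "y\<^sup>2 + t\<^sup>2 \<noteq> 0" using t by (simp add: sum_power2_eq_zero_iff)
    have aux: "u / (u + v) = u / v - u / v * (u / (u + v))" if "v \<noteq> 0" "u + v \<noteq> 0" for u v :: real
    proof -
      have "1 - u / (u + v) = v / (u + v)" using that by (simp add: divide_simps)
      hence "u / v * (1 - u / (u + v)) = u / (u + v)" using that by simp
      thus ?thesis by (simp add: right_diff_distrib)
    qed
    have "q = x - x * q" unfolding q_def x_def using t by (intro aux yt) auto
    hence "q = (\<Sum>j=1..m. (- 1) ^ (j - 1) * x ^ j) + (- 1) ^ m * x ^ m * q" by (rule geometric_split)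
    hence "complex_of_real q = of_real ((\<Sum>j=1..m. (- 1) ^ (j - 1) * x ^ j) + (- 1) ^ m * x ^ m * q)"
      by (rule arg_cong)
    also have "\<dots> = (\<Sum>j=1..m. (- 1) ^ (j - 1) * of_real x ^ j) + (- 1) ^ m * of_real x ^ m * of_real q"
      by simp
    finally have "of_real t powr (s - 1) * (complex_of_real q * of_real (chi3_kernel t)) =
       of_real t powr (s - 1) * (((\<Sum>j=1..m. (- 1) ^ (j - 1) * of_real x ^ j) +
         (- 1) ^ m * of_real x ^ m * of_real q) * of_real (chi3_kernel t))"
      by (rule arg_cong)
    also have "\<dots> = (\<Sum>j=1..m. (- 1) ^ (j - 1) * (of_real t powr (s - 1) * of_real x ^ j) * of_real (chi3_kernel t)) +
       (- 1) ^ m * (of_real t powr (s - 1) * of_real x ^ m) * (of_real q * of_real (chi3_kernel t))"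
      by (simp add: distrib_left distrib_right sum_distrib_left sum_distrib_right mult_ac)
    finally have key: "of_real t powr (s - 1) * complex_of_real (q * chi3_kernel t) =
      (\<Sum>j=1..m. (- 1) ^ (j - 1) * (of_real t powr (s - 1) * of_real x ^ j) * of_real (chi3_kernel t)) +
       (- 1) ^ m * (of_real t powr (s - 1) * of_real x ^ m) * (of_real q * of_real (chi3_kernel t))"
      by (simp only: of_real_mult)
    have shift: "of_real t powr (s - 1) * of_real x ^ j = of_real t powr (s - of_nat (2 * j) - 1) * Y ^ (2 * j)" for j
      unfolding powr_shift[OF t, of j] using t by (simp add: x_def Y_def power_divide power_mult)
    have "f j t = (- 1) ^ (j - 1) * (of_real t powr (s - of_nat (2 * j) - 1) * Y ^ (2 * j)) * of_real (chi3_kernel t)" for j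
      by (simp only: f_def mult_ac)
    moreover have "g t = (- 1) ^ m * (of_real t powr (s - of_nat (2 * m) - 1) * Y ^ (2 * m)) * (of_real q * of_real (chi3_kernel t))"
      by (simp only: g_def s'_def q_def of_real_mult mult_ac)
    ultimately show "(\<Sum>j=1..m. f j t) + g t = of_real t powr (s - 1) * of_real (y\<^sup>2 / (y\<^sup>2 + t\<^sup>2) * chi3_kernel t)"
      using key unfolding shift by (simp only: q_def)
  qed simp
  hence I: "chi3_integral s y = (\<Sum>j=1..m. c j) + (- 1) ^ m * Y ^ (2 * m) * G"
    unfolding chi3_integral_def by (rule has_bochner_integral_integral_eq)
  have "sin (of_real pi * s' / 2) = (- 1) ^ m * sin (of_real pi * s / 2)"
    using sin_minus_nat_pi[of "of_real pi * s / 2" m] by (simp add: s'_def algebra_simps diff_divide_distrib)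
  hence "of_real pi / (2 * sin (of_real pi * s' / 2)) = (- 1) ^ m * K"
    by (cases "even m") (simp_all add: K_def)
  hence G: "(- 1) ^ m * Y ^ (2 * m) * G = K / E * (Y ^ (2 * m) * Y powr s' + 2 / r3 * Y ^ (2 * (m + 1)) * (A - B))"
    unfolding G_def by (cases "even m") (simp_all add: algebra_simps power2_eq_square)
  have Ys: "Y ^ (2 * m) * Y powr s' = Y powr s"
    using of_real_powr_nat_shift[OF y, of s' "2 * m"] by (simp add: s'_def Y_def mult.commute)
  have P: "(\<Sum>j=1..m. c j) = polynomial_part s Y"
    unfolding polynomial_part_def c_def m_def by (intro sum.cong refl) (simp only: mult_ac)
  have gam: "gamma_star s Y = E * (- (3 powr s) * polynomial_part s Y) +
     2 * K * (3 powr s / r3) * Y ^ (2 * (m + 1)) * (- A + B)"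
    unfolding gamma_star_eq E_def three_powr_minus_half r3_def K_def A_def B_def residual_exponent_def s'_def m_def
    by simp
  have phi: "phi_star s y = 3 powr s * K * Y powr s"
    using y by (simp add: phi_star_eq K_def Y_def)
  have "phi_star s y - gamma_star s Y = 3 powr s * E * chi3_integral s y"
  proof -
    define R where "R = Y ^ (2 * (m + 1)) * (A - B) / r3"
    have "2 * K * (3 powr s / r3) * Y ^ (2 * (m + 1)) * (- A + B) = - (2 * K * 3 powr s * R)"
      using r3 by (simp add: R_def field_simps)
    moreover have "2 / r3 * Y ^ (2 * (m + 1)) * (A - B) = 2 * R" by (simp add: R_def)
    ultimately show ?thesis
      unfolding gam phi I G Ys P using E by (simp only:) (simp add: algebra_simps)
  qed
  thus ?thesis by (simp add: E_def Y_def)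
qed

end

subsection \<open>The remainder\<close>

lemma norm_one_plus_2cos_of_real_le: "norm (1 + 2 * cos (complex_of_real y)) \<le> 3"
proof -
  have "1 + 2 * cos (complex_of_real y) = of_real (1 + 2 * cos y)" by (simp add: cos_of_real)
  hence "norm (1 + 2 * cos (complex_of_real y)) = \<bar>1 + 2 * cos y\<bar>" by (simp only: norm_of_real)
  also have "\<dots> \<le> 3" using abs_cos_le_one[of y] by linarith
  finally show ?thesis .
qed

text \<open>The opposite signs compensate the opposite signs of the two series in
  \<open>gamma_star\<close>, so that both families of nodes receive the same interpolated
  formula.\<close>

lemma sin_node: "sin (node (1 / 3) k) = sqrt 3 / 2" "sin (node (2 / 3) k) = - (sqrt 3 / 2)"
proof -
  have "node (1 / 3) k = 2 * pi / 3 + 2 * pi * of_int (int k)" by (simp add: node_def algebra_simps)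
  hence "sin (node (1 / 3) k) = sin (2 * pi / 3)" by (simp only: sin_add sin_int_2pin cos_int_2pin mult_1_right mult_zero_right add_0_right)
  thus "sin (node (1 / 3) k) = sqrt 3 / 2" by (simp only: cos_sin_2pi_thirds)
  have "node (2 / 3) k = - (2 * pi / 3) + 2 * pi * of_int (int (k + 1))" by (simp add: node_def algebra_simps)
  hence "sin (node (2 / 3) k) = sin (- (2 * pi / 3))" by (simp only: sin_add sin_int_2pin cos_int_2pin mult_1_right mult_zero_right add_0_right)
  thus "sin (node (2 / 3) k) = - (sqrt 3 / 2)" by (simp only: sin_minus cos_sin_2pi_thirds)
qed

lemma node_neq: "node (1 / 3) j \<noteq> node (2 / 3) k"
proof
  assume "node (1 / 3) j = node (2 / 3) k"
  hence "real (3 * j) = real (3 * k + 1)" by (simp add: node_def)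
  hence "3 * j = 3 * k + 1" by (simp only: of_nat_eq_iff)
  thus False by presburger
qed

text \<open>Since \<open>- 1 / 3\<close> and \<open>2 / 3\<close> differ by 1, the family of a node
  depends on its sign, and the indices \<open>- d - 1\<close> and \<open>d - 1\<close> carry the
  shift.\<close>

lemma nodes_cases:
  assumes "x \<in> nodes"
  obtains c k where "c \<in> {1 / 3, 2 / 3}" "\<bar>x\<bar> = node c k"
proof -
  from assms obtain d :: int where "x = 2 * pi * (of_int d + 1 / 3) \<or> x = 2 * pi * (of_int d - 1 / 3)"
    unfolding nodes_def by auto
  thus thesis
  proof
    assume x: "x = 2 * pi * (of_int d + 1 / 3)"
    show thesis
    proof (cases "d \<ge> 0")
      case True
      hence "x = node (1 / 3) (nat d)" using x by (simp add: node_def)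
      thus thesis using that[of "1 / 3" "nat d"] node_pos[of "1 / 3" "nat d"] by simp
    next
      case False
      hence "x = - node (2 / 3) (nat (- d - 1))" using x by (simp add: node_def algebra_simps)
      thus thesis using that[of "2 / 3" "nat (- d - 1)"] node_pos[of "2 / 3" "nat (- d - 1)"] by simp
    qed
  next
    assume x: "x = 2 * pi * (of_int d - 1 / 3)"
    show thesis
    proof (cases "d \<le> 0")
      case True
      hence "x = - node (1 / 3) (nat (- d))" using x by (simp add: node_def algebra_simps)
      thus thesis using that[of "1 / 3" "nat (- d)"] node_pos[of "1 / 3" "nat (- d)"] by simp
    next
      case False
      hence "x = node (2 / 3) (nat (d - 1))" using x by (simp add: node_def algebra_simps)
      thus thesis using that[of "2 / 3" "nat (d - 1)"] node_pos[of "2 / 3" "nat (d - 1)"] by simp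
    qed
  qed
qed

context
  fixes s :: complex
  assumes pos: "Re s > 0" and not_even: "\<And>k::nat. k \<ge> 1 \<Longrightarrow> Re s \<noteq> 2 * real k"
begin

text \<open>As \<open>phi_star\<close> depends on \<open>\<bar>y\<bar>\<close> only, evenness of the
  interpolant reduces all statements on the real line to \<open>y > 0\<close>.\<close>

lemma gamma_star_minus: "gamma_star s (- z) = gamma_star s z"
proof -
  have "(- z) ^ (2 * j) = z ^ (2 * j)" for j by (simp add: power_mult)
  moreover have "cos_series c (residual_exponent s) (- z) = cos_series c (residual_exponent s) z"
    if "c \<in> {1 / 3, 2 / 3}" for c
    by (rule cos_series_minus[OF that Re_residual_exponent[OF pos not_even]])
  ultimately show ?thesis unfolding gamma_star_eq polynomial_part_def by (simp only: cos_minus insertI1 insertI2)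
qed

lemma gamma_star_abs: "gamma_star s (of_real \<bar>y\<bar>) = gamma_star s (of_real y)"
  using gamma_star_minus[of "of_real y"] by (cases "y \<ge> 0") auto

text \<open>At a node the factor \<open>1 + 2 * cos z\<close> removes the polynomial part, and the
  series over the other family vanishes. The surviving term carries \<open>sqrt 3 / 2\<close> from
  the sine, which cancels the \<open>sqrt 3\<close> hidden in \<open>3 powr (s - 1 / 2)\<close>, and
  the exponents add up to \<open>s\<close>.\<close>

lemma gamma_star_node:
  assumes c: "c \<in> {1 / 3, 2 / 3}"
  shows "gamma_star s (of_real (node c k)) = phi_star s (node c k)"
proof -
  define a where "a = complex_of_real (node c k)"
  define p where "p = residual_exponent s"
  note Re = Re_residual_exponent[OF pos not_even]
  note node = node_pos_zero[OF c Re, of k]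
  have Rep: "Re p < 1" using Re by (simp add: p_def)
  have sq: "(complex_of_real x)\<^sup>2 \<noteq> (of_real y)\<^sup>2" if "x > 0" "y > 0" "x \<noteq> y" for x y
    using that by (auto simp: power2_eq_iff simp flip: of_real_minus)
  have npos: "node (1 / 3) d > 0" "node (2 / 3) d > 0" for d by (auto intro: node_pos)
  have eq: "- cos_series (1 / 3) p a + cos_series (2 / 3) p a = of_real (sqrt 3) / 2 * a powr (p - 1)"
  proof (cases "c = 1 / 3")
    case True
    hence a1: "a = of_real (node (1 / 3) k)" by (simp only: a_def)
    have "cos_series (1 / 3) p a = - of_real (sin (node (1 / 3) k)) * a powr (p - 1)"
      unfolding a1 by (rule cos_series_at_node[OF _ Rep]) auto
    moreover have "cos_series (2 / 3) p a = 0"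
    proof (rule cos_series_at_zero[OF _ Rep])
      show "a\<^sup>2 \<noteq> (of_real (node (2 / 3) d))\<^sup>2" for d
        unfolding a1 by (rule sq[OF npos node_neq])
    qed (use node(2) in \<open>auto simp: a_def\<close>)
    ultimately show ?thesis by (simp add: sin_node)
  next
    case False
    hence "c = 2 / 3" using c by blast
    hence a2: "a = of_real (node (2 / 3) k)" by (simp only: a_def)
    have "cos_series (2 / 3) p a = - of_real (sin (node (2 / 3) k)) * a powr (p - 1)"
      unfolding a2 by (rule cos_series_at_node[OF _ Rep]) auto
    moreover have "cos_series (1 / 3) p a = 0"
    proof (rule cos_series_at_zero[OF _ Rep])
      show "a\<^sup>2 \<noteq> (of_real (node (1 / 3) d))\<^sup>2" for d
        unfolding a2 by (rule sq[OF npos(2,1) node_neq[symmetric]])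
    qed (use node(2) in \<open>auto simp: a_def\<close>)
    ultimately show ?thesis by (simp add: sin_node)
  qed
  have D0: "1 + 2 * cos a = 0" using node(2) by (simp only: a_def)
  have "gamma_star s a = of_real pi * (3 powr s / of_real (sqrt 3)) * a ^ (2 * (m1 s + 1)) / sin (of_real pi * s / 2) *
      (of_real (sqrt 3) / 2 * a powr (p - 1))"
    unfolding gamma_star_eq three_powr_minus_half p_def[symmetric] eq D0 by simp
  also have "\<dots> = of_real pi * 3 powr s * (a powr (p - 1) * a ^ (2 * (m1 s + 1))) / (2 * sin (of_real pi * s / 2))"
    by (simp add: mult_ac)
  also have "a powr (p - 1) * a ^ (2 * (m1 s + 1)) = a powr s"
    using of_real_powr_nat_shift[OF node(1), of "p - 1" "2 * (m1 s + 1)"]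
    by (simp add: a_def p_def residual_exponent_def algebra_simps)
  also have "of_real pi * 3 powr s * a powr s / (2 * sin (of_real pi * s / 2)) = phi_star s (node c k)"
    using node(1) by (simp add: phi_star_eq a_def)
  finally show ?thesis by (simp add: a_def)
qed

lemma gamma_star_interpolates:
  assumes "x \<in> nodes"
  shows "gamma_star s (of_real x) = phi_star s x"
proof -
  obtain c k where "c \<in> {1 / 3, 2 / 3}" "\<bar>x\<bar> = node c k" using assms by (rule nodes_cases)
  thus ?thesis using gamma_star_node[of c k] gamma_star_abs[of x] phi_star_abs[of s x] by simp
qed

lemma gamma_star_holomorphic: "gamma_star s holomorphic_on UNIV"
  unfolding gamma_star_eq[abs_def] polynomial_part_def divide_inverse
  using Re_residual_exponent[OF pos not_even]
  by (intro holomorphic_intros cos_series_holomorphic) auto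

lemma of_exp_type_gamma_star: "of_exp_type (gamma_star s) 1"
proof -
  have const: "of_exp_type (\<lambda>z. c * f z) \<sigma>" if "of_exp_type f \<sigma>" for c f \<sigma>
    using of_exp_type_mult[OF of_exp_type_const that] by simp
  have "of_exp_type (polynomial_part s) 0"
    unfolding polynomial_part_def[abs_def] by (intro of_exp_type_sum const of_exp_type_power)
  hence 1: "of_exp_type (\<lambda>z. (1 + 2 * cos z) * (- (3 powr s) * polynomial_part s z)) 1"
    using of_exp_type_mult[OF of_exp_type_one_plus_2cos const, of "polynomial_part s" 0 "- (3 powr s)"] by simp
  have cs: "of_exp_type (cos_series c (residual_exponent s)) 1" if "c \<in> {1 / 3, 2 / 3}" for c
    by (rule of_exp_type_cos_series[OF that Re_residual_exponent[OF pos not_even]])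
  have "of_exp_type (\<lambda>z. - 1 * cos_series (1 / 3) (residual_exponent s) z + cos_series (2 / 3) (residual_exponent s) z) 1"
    by (intro of_exp_type_add const cs) auto
  from of_exp_type_mult[OF of_exp_type_power[of "2 * (m1 s + 1)"] this]
  have 2: "of_exp_type (\<lambda>z. (of_real pi * 3 powr (s - 1 / 2) / sin (of_real pi * s / 2)) *
    (z ^ (2 * (m1 s + 1)) * (- cos_series (1 / 3) (residual_exponent s) z + cos_series (2 / 3) (residual_exponent s) z))) 1"
    by (intro const) simp
  show ?thesis unfolding gamma_star_eq[abs_def] using of_exp_type_add[OF 1 2] by (simp add: mult_ac)
qed

lemma integral_powr_chi3_kernel:
  "integrable pos_reals (\<lambda>t. of_real t powr (s - 1) * complex_of_real (chi3_kernel t))"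
  "(\<integral>t. of_real t powr (s - 1) * complex_of_real (chi3_kernel t) \<partial>pos_reals) = Gamma s * L_chi3 s"
  using has_bochner_integral_L_chi3[OF pos] by (auto simp: has_bochner_integral_iff)

lemma chi3_weight_bounds:
  fixes t y :: real
  assumes "t > 0" "y \<noteq> 0"
  shows "0 \<le> y\<^sup>2 / (y\<^sup>2 + t\<^sup>2)" "y\<^sup>2 / (y\<^sup>2 + t\<^sup>2) \<le> 1" "\<bar>y\<^sup>2 / (y\<^sup>2 + t\<^sup>2) - 1\<bar> \<le> t\<^sup>2 / y\<^sup>2"
proof -
  have p: "y\<^sup>2 + t\<^sup>2 > 0" using assms(1) by (intro add_nonneg_pos) auto
  show "0 \<le> y\<^sup>2 / (y\<^sup>2 + t\<^sup>2)" "y\<^sup>2 / (y\<^sup>2 + t\<^sup>2) \<le> 1" using p by auto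
  have "y\<^sup>2 / (y\<^sup>2 + t\<^sup>2) - 1 = - (t\<^sup>2 / (y\<^sup>2 + t\<^sup>2))"
  proof -
    have "(y\<^sup>2 + t\<^sup>2) / (y\<^sup>2 + t\<^sup>2) = 1" using p by (intro divide_self) linarith
    moreover have "y\<^sup>2 / (y\<^sup>2 + t\<^sup>2) - (y\<^sup>2 + t\<^sup>2) / (y\<^sup>2 + t\<^sup>2) = - (t\<^sup>2 / (y\<^sup>2 + t\<^sup>2))"
      by (simp only: diff_divide_distrib[symmetric] minus_divide_left) simp
    ultimately show ?thesis by (simp only:)
  qed
  hence "\<bar>y\<^sup>2 / (y\<^sup>2 + t\<^sup>2) - 1\<bar> = t\<^sup>2 / (y\<^sup>2 + t\<^sup>2)" using p by simp
  also have "\<dots> \<le> t\<^sup>2 / y\<^sup>2" using assms p by (intro divide_left_mono) auto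
  finally show "\<bar>y\<^sup>2 / (y\<^sup>2 + t\<^sup>2) - 1\<bar> \<le> t\<^sup>2 / y\<^sup>2" .
qed

text \<open>The weight lies between 0 and 1, so one integral bounds the remainder for all
  \<open>y\<close> at once.\<close>

lemma norm_chi3_integral_le:
  assumes y: "y \<noteq> 0"
  shows "norm (chi3_integral s y) \<le> (\<integral>t. norm (of_real t powr (s - 1) * complex_of_real (chi3_kernel t)) \<partial>pos_reals)"
    (is "_ \<le> (\<integral>t. norm (?f t) \<partial>pos_reals)")
    and integrable_chi3_integrand:
    "integrable pos_reals (\<lambda>t. of_real t powr (s - 1) * complex_of_real (y\<^sup>2 / (y\<^sup>2 + t\<^sup>2) * chi3_kernel t))"
    (is "integrable _ ?g")
proof -
  have le: "norm (?g t) \<le> norm (?f t)" if "t > 0" for t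
  proof -
    have "norm (?g t) = y\<^sup>2 / (y\<^sup>2 + t\<^sup>2) * norm (?f t)"
      using chi3_weight_bounds(1)[OF that y] by (simp only: norm_mult norm_of_real abs_mult abs_of_nonneg mult_ac)
    also have "\<dots> \<le> 1 * norm (?f t)"
      using chi3_weight_bounds(2)[OF that y] by (rule mult_right_mono) simp
    finally show ?thesis by simp
  qed
  have "?g \<in> borel_measurable pos_reals"
    using y by (intro borel_measurable_pos_reals continuous_intros) (auto simp: add_nonneg_eq_0_iff)
  thus "integrable pos_reals ?g"
    using le by (intro Bochner_Integration.integrable_bound[OF integral_powr_chi3_kernel(1)] AE_I2) auto
  have "norm (chi3_integral s y) \<le> (\<integral>t. norm (?g t) \<partial>pos_reals)"
    unfolding chi3_integral_def by (rule integral_norm_bound)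
  also have "\<dots> \<le> (\<integral>t. norm (?f t) \<partial>pos_reals)"
    using le by (intro integral_mono' integrable_norm integral_powr_chi3_kernel) auto
  finally show "norm (chi3_integral s y) \<le> (\<integral>t. norm (?f t) \<partial>pos_reals)" .
qed

text \<open>The weight differs from 1 by at most \<open>t^2 / y^2\<close>. The extra
  \<open>t^2\<close> turns \<open>s\<close> into \<open>s + 2\<close>, where the kernel integral
  still converges, so the error is of order \<open>1 / y^2\<close>, for both signs of
  \<open>y\<close>.\<close>

lemma chi3_integral_tendsto: "(chi3_integral s \<longlongrightarrow> Gamma s * L_chi3 s) at_infinity"
proof -
  define C where "C = (\<integral>t. norm (of_real t powr (s + 2 - 1) * complex_of_real (chi3_kernel t)) \<partial>pos_reals)"
  have int: "integrable pos_reals (\<lambda>t. norm (of_real t powr (s + 2 - 1) * complex_of_real (chi3_kernel t)))"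
    using pos by (intro integrable_norm integrable.intros[OF has_bochner_integral_L_chi3]) auto
  have bound: "norm (chi3_integral s y - Gamma s * L_chi3 s) \<le> (inverse y)\<^sup>2 * C" if y: "y \<noteq> 0" for y
  proof -
    define d where "d = (\<lambda>t. of_real t powr (s - 1) * complex_of_real (y\<^sup>2 / (y\<^sup>2 + t\<^sup>2) * chi3_kernel t)
        - of_real t powr (s - 1) * complex_of_real (chi3_kernel t))"
    have "chi3_integral s y - Gamma s * L_chi3 s = integral\<^sup>L pos_reals d"
      unfolding chi3_integral_def d_def integral_powr_chi3_kernel(2)[symmetric]
      by (rule Bochner_Integration.integral_diff[symmetric, OF integrable_chi3_integrand[OF y] integral_powr_chi3_kernel(1)])
    also have "norm \<dots> \<le> (\<integral>t. norm (d t) \<partial>pos_reals)" by (rule integral_norm_bound)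
    also have "\<dots> \<le> (\<integral>t. (inverse y)\<^sup>2 * norm (of_real t powr (s + 2 - 1) * complex_of_real (chi3_kernel t)) \<partial>pos_reals)"
    proof (rule integral_mono')
      fix t assume "t \<in> space pos_reals"
      hence t: "t > 0" by simp
      have "d t = of_real t powr (s - 1) * complex_of_real (chi3_kernel t) * of_real (y\<^sup>2 / (y\<^sup>2 + t\<^sup>2) - 1)"
        unfolding d_def by (simp only: of_real_mult of_real_diff of_real_1 right_diff_distrib mult_1_left mult_ac)
      hence "norm (d t) = norm (of_real t powr (s - 1) * complex_of_real (chi3_kernel t)) * \<bar>y\<^sup>2 / (y\<^sup>2 + t\<^sup>2) - 1\<bar>"
        by (simp only: norm_mult norm_of_real)
      also have "\<dots> \<le> norm (of_real t powr (s - 1) * complex_of_real (chi3_kernel t)) * (t\<^sup>2 / y\<^sup>2)"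
        using chi3_weight_bounds(3)[OF t y] by (rule mult_left_mono) simp
      also have "\<dots> = (inverse y)\<^sup>2 * norm (of_real t powr (s + 2 - 1) * complex_of_real (chi3_kernel t))"
      proof -
        have "of_real t powr (s + 2 - 1) = complex_of_real t powr (s - 1) * of_real t ^ 2"
          using of_real_powr_nat_shift[OF t, of "s - 1" 2] by (simp add: algebra_simps)
        thus ?thesis by (simp add: norm_mult norm_power divide_inverse power_inverse mult_ac)
      qed
      finally show "norm (d t) \<le> (inverse y)\<^sup>2 * norm (of_real t powr (s + 2 - 1) * complex_of_real (chi3_kernel t))" .
    qed (use int in auto)
    also have "\<dots> = (inverse y)\<^sup>2 * C" unfolding C_def by (rule integral_mult_right_zero)
    finally show ?thesis .
  qed
  have "((\<lambda>y::real. (inverse y)\<^sup>2 * C) \<longlongrightarrow> 0\<^sup>2 * C) at_infinity"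
    by (intro tendsto_intros tendsto_inverse_0)
  hence "((\<lambda>y::real. (inverse y)\<^sup>2 * C) \<longlongrightarrow> 0) at_infinity" by simp
  moreover have "eventually (\<lambda>y::real. y \<noteq> 0) at_infinity"
    unfolding eventually_at_infinity by (intro exI[of _ 1]) auto
  hence "eventually (\<lambda>y. norm (chi3_integral s y - Gamma s * L_chi3 s) \<le> (inverse y)\<^sup>2 * C) at_infinity"
    by eventually_elim (rule bound)
  ultimately have "((\<lambda>y. chi3_integral s y - Gamma s * L_chi3 s) \<longlongrightarrow> 0) at_infinity"
    by (rule Lim_null_comparison[rotated])
  thus ?thesis by (simp add: LIM_zero_iff)
qed

lemma chi3_integral_abs: "chi3_integral s \<bar>y\<bar> = chi3_integral s y"
  by (simp add: chi3_integral_def)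

lemma phi_star_minus_gamma_star:
  assumes y: "y \<noteq> 0" and D: "1 + 2 * cos (complex_of_real y) \<noteq> 0"
  shows "phi_star s y - gamma_star s (of_real y) = 3 powr s * (1 + 2 * cos (of_real y)) * chi3_integral s y"
proof -
  have c: "cos (complex_of_real \<bar>y\<bar>) = cos (of_real y)" by (cases "y \<ge> 0") auto
  have "phi_star s \<bar>y\<bar> - gamma_star s (of_real \<bar>y\<bar>) = 3 powr s * (1 + 2 * cos (of_real \<bar>y\<bar>)) * chi3_integral s \<bar>y\<bar>"
    using y D c by (intro chi3_integral_representation[OF pos not_even]) auto
  thus ?thesis unfolding phi_star_abs gamma_star_abs chi3_integral_abs c .
qed

lemma gamma_star_0: "gamma_star s 0 = 0"
proof -
  have "polynomial_part s 0 = 0" unfolding polynomial_part_def by (intro sum.neutral) auto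
  thus ?thesis by (simp add: gamma_star_eq)
qed

lemma phi_star_measurable: "phi_star s \<in> borel_measurable borel"
proof -
  \<comment> \<open>Away from 0 the power is an exponential of a real logarithm; the case
    distinction reproduces the convention \<open>0 powr s = 0\<close>.\<close>
  have "phi_star s = (\<lambda>y. of_real pi * (if y = 0 then 0 else exp (s * of_real (ln (3 * \<bar>y\<bar>)))) /
      (2 * sin (of_real pi * s / 2)))"
  proof
    fix y :: real
    show "phi_star s y = of_real pi * (if y = 0 then 0 else exp (s * of_real (ln (3 * \<bar>y\<bar>)))) /
      (2 * sin (of_real pi * s / 2))"
      using of_real_powr_pos[of "3 * \<bar>y\<bar>" s] by (simp add: phi_star_def)
  qed
  also have "\<dots> \<in> borel_measurable borel" by measurable
  finally show ?thesis .
qed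

lemma gamma_star_admissible: "admissible_interpolant s (gamma_star s)"
  unfolding admissible_interpolant_def
proof (intro conjI ballI)
  show "in_L_infinity (\<lambda>x. phi_star s x - gamma_star s (of_real x))"
    unfolding in_L_infinity_def
  proof (intro conjI exI AE_I2)
    have "continuous_on UNIV (\<lambda>x::real. gamma_star s (of_real x))"
      by (intro continuous_on_compose2[OF holomorphic_on_imp_continuous_on[OF gamma_star_holomorphic]] continuous_intros) auto
    hence "(\<lambda>x. phi_star s x - gamma_star s (of_real x)) \<in> borel_measurable borel"
      by (intro borel_measurable_diff phi_star_measurable borel_measurable_continuous_onI)
    thus "(\<lambda>x. phi_star s x - gamma_star s (of_real x)) \<in> borel_measurable lebesgue"
      by (intro measurable_completion) simp
    fix x :: real
    define M where "M = (\<integral>t. norm (of_real t powr (s - 1) * complex_of_real (chi3_kernel t)) \<partial>pos_reals)"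
    have M0: "M \<ge> 0" unfolding M_def by (rule integral_nonneg_AE) auto
    show "norm (phi_star s x - gamma_star s (of_real x)) \<le>
      norm (3 powr s) * 3 * (\<integral>t. norm (of_real t powr (s - 1) * complex_of_real (chi3_kernel t)) \<partial>pos_reals)"
      unfolding M_def[symmetric]
    \<comment> \<open>The integral formula is available only off the origin and the nodes. At the
      exceptional points the difference is 0 by normalization and by interpolation, so the bound
      holds everywhere and not only almost everywhere.\<close>
    proof (cases "x = 0 \<or> 1 + 2 * cos (complex_of_real x) = 0")
      case True
      hence "phi_star s x - gamma_star s (of_real x) = 0"
      proof
        assume "x = 0"
        thus ?thesis by (simp add: gamma_star_0 phi_star_def)
      next
        assume "1 + 2 * cos (complex_of_real x) = 0"
        hence "x \<in> nodes" unfolding one_plus_2cos_eq_0_iff by auto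
        thus ?thesis by (simp add: gamma_star_interpolates)
      qed
      thus "norm (phi_star s x - gamma_star s (of_real x)) \<le> norm (3 powr s) * 3 * M" using M0 by simp
    next
      case False
      hence "norm (phi_star s x - gamma_star s (of_real x)) =
          norm (3 powr s) * norm (1 + 2 * cos (complex_of_real x)) * norm (chi3_integral s x)"
        by (simp add: phi_star_minus_gamma_star norm_mult)
      also have "\<dots> \<le> norm (3 powr s) * 3 * M"
        unfolding M_def using False
        by (intro mult_mono mult_left_mono norm_one_plus_2cos_of_real_le norm_chi3_integral_le mult_nonneg_nonneg) auto
      finally show "norm (phi_star s x - gamma_star s (of_real x)) \<le> norm (3 powr s) * 3 * M" .
    qed
  qed
qed (use gamma_star_holomorphic of_exp_type_gamma_star gamma_star_interpolates gamma_star_0 in auto)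

lemma remainder_tendsto:
  "((\<lambda>y::real. (phi_star s y - gamma_star s (of_real y)) / (1 + 2 * cos (of_real y)))
      \<longlongrightarrow> 3 powr s * (Gamma s * L_chi3 s)) (inf at_infinity (principal {y. 1 + 2 * cos y \<noteq> 0}))"
proof (rule Lim_transform_eventually)
  have "((\<lambda>y. 3 powr s * chi3_integral s y) \<longlongrightarrow> 3 powr s * (Gamma s * L_chi3 s)) at_infinity"
    by (intro tendsto_intros chi3_integral_tendsto)
  thus "((\<lambda>y. 3 powr s * chi3_integral s y) \<longlongrightarrow> 3 powr s * (Gamma s * L_chi3 s))
          (inf at_infinity (principal {y. 1 + 2 * cos y \<noteq> 0}))"
    by (rule filterlim_mono) auto
  have "eventually (\<lambda>y::real. y \<noteq> 0) at_infinity"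
    unfolding eventually_at_infinity by (intro exI[of _ 1]) auto
  thus "eventually (\<lambda>y. 3 powr s * chi3_integral s y =
      (phi_star s y - gamma_star s (of_real y)) / (1 + 2 * cos (of_real y)))
      (inf at_infinity (principal {y. 1 + 2 * cos y \<noteq> 0}))"
    unfolding eventually_inf_principal
  proof eventually_elim
    case (elim y)
    show ?case
    proof
      assume "y \<in> {y. 1 + 2 * cos y \<noteq> 0}"
      moreover have "1 + 2 * cos (complex_of_real y) = of_real (1 + 2 * cos y)" by (simp add: cos_of_real)
      ultimately have "1 + 2 * cos (complex_of_real y) \<noteq> 0" by (simp only: of_real_eq_0_iff) simp
      with elim show "3 powr s * chi3_integral s y =
          (phi_star s y - gamma_star s (of_real y)) / (1 + 2 * cos (of_real y))"
        by (simp add: phi_star_minus_gamma_star)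
    qed
  qed
qed

end

theorem corollary2p11:
  fixes s :: complex
  assumes "Re s > 0"
    and "\<And>k::nat. k \<ge> 1 \<Longrightarrow> Re s \<noteq> 2 * real k"
    and "\<And>n::nat. n \<ge> 1 \<Longrightarrow> s \<noteq> of_nat n"
  shows
    "(admissible_interpolant s (gamma_star s) \<and>
      (\<forall>g. admissible_interpolant s g \<longrightarrow> g = gamma_star s))
     \<and>
     (\<forall>d::int. \<forall>\<epsilon>\<in>{1, -1::real}.
        phi_star s (2 * pi * (of_int d + \<epsilon> / 3)) =
          gamma_star s (of_real (2 * pi * (of_int d + \<epsilon> / 3))) \<and>
        gamma_star s (of_real (2 * pi * (of_int d + \<epsilon> / 3))) =
          of_real pi * 3 powr s * of_real (2 * pi * \<bar>of_int d + \<epsilon> / 3\<bar>) powr s /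
            (2 * sin (of_real pi * s / 2)))
     \<and>
     (\<exists>l. ((\<lambda>y::real. (phi_star s y - gamma_star s (of_real y)) / (1 + 2 * cos (of_real y)))
              \<longlongrightarrow> l) (inf at_infinity (principal {y. 1 + 2 * cos y \<noteq> 0}))
          \<and> L_chi3 s = 1 / (3 powr s * Gamma s) * l)"
proof (intro conjI allI impI ballI)
  note adm = gamma_star_admissible[OF assms(1,2)]
  show "admissible_interpolant s (gamma_star s)" by (rule adm)
  show "g = gamma_star s" if "admissible_interpolant s g" for g
    using that adm by (rule admissible_interpolant_unique)
  show "\<exists>l. ((\<lambda>y::real. (phi_star s y - gamma_star s (of_real y)) / (1 + 2 * cos (of_real y)))
              \<longlongrightarrow> l) (inf at_infinity (principal {y. 1 + 2 * cos y \<noteq> 0}))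
          \<and> L_chi3 s = 1 / (3 powr s * Gamma s) * l"
    using remainder_tendsto[OF assms(1,2)] Gamma_nonzero_Re_pos[OF assms(1)]
    by (intro exI[of _ "3 powr s * (Gamma s * L_chi3 s)"]) simp
  fix d :: int and \<epsilon> :: real assume "\<epsilon> \<in> {1, - 1}"
  hence "2 * pi * (of_int d + \<epsilon> / 3) \<in> nodes" unfolding nodes_def by auto
  from gamma_star_interpolates[OF assms(1,2) this]
  show eq: "phi_star s (2 * pi * (of_int d + \<epsilon> / 3)) = gamma_star s (of_real (2 * pi * (of_int d + \<epsilon> / 3)))"
    by simp
  have "\<bar>2 * pi * (of_int d + \<epsilon> / 3)\<bar> = 2 * pi * \<bar>of_int d + \<epsilon> / 3\<bar>" by (simp add: abs_mult)
  thus "gamma_star s (of_real (2 * pi * (of_int d + \<epsilon> / 3))) =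
          of_real pi * 3 powr s * of_real (2 * pi * \<bar>of_int d + \<epsilon> / 3\<bar>) powr s /
            (2 * sin (of_real pi * s / 2))"
    unfolding eq[symmetric] phi_star_eq by (simp only:)
qed

end
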